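(* $SC_{2,2}INS_1^{0,0}DEL_1^{0,0}=RE$. That is, a language is recursively enumerable if and only if it is generated by some semi-conditional insertion-deletion system of degree $(2,2)$ with insertion and deletion rules of size $(1,0,0;1,0,0)$.
   Context: $\lambda$ denotes the empty string and $RE$ the family of recursively enumerable languages. An insertion rule $(u,\alpha,v)_{ins}$ and a deletion rule $(u,\alpha,v)_{del}$ over an alphabet $V$ are given by strings $u,\alpha,v\in V^*$ with $\alpha\neq\lambda$. For $x,y\in V^*$: $x\Rightarrow_{ins}y$ via $(u,\alpha,v)_{ins}$ if $x=x_1uvx_2$, $y=x_1u\alpha vx_2$ for some $x_1,x_2\in V^*$; $x\Rightarrow_{del}y$ via $(u,\alpha,v)_{del}$ if $x=x_1u\alpha vx_2$, $y=x_1uvx_2$ for some $x_1,x_2\in V^*$. A semi-conditional insertion-deletion system of degree $(i,j)$, $i,j\ge 1$, is a construct $\gamma=(V,T,A,R)$ where $V$ is a finite alphabet, $T\subseteq V$ is the terminal alphabet, $A\subseteq V^*$ is a finite set of axioms, and $R$ is a finite set of rules of the form $r=\bigl((a,b,c)_t,P,Q\bigr)$, where $t\in\{ins,del\}$, $(a,b,c)_t$ is an insertion rule if $t=ins$ and a deletion rule if $t=del$, $P$ (the permitting condition) is a finite set of nonempty words over $V$ of length at most $i$, and $Q$ (the forbidding condition) is a finite set of nonempty words over $V$ of length at most $j$ (either may be empty). For such a rule $r$, a transition $w\Longrightarrow_r w'$ between strings $w,w'\in V^*$ is performed if $w\Rightarrow_t w'$ via $(a,b,c)_t$, every $x\in P$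 is a (contiguous) subword of $w$, and no $y\in Q$ is a subword of $w$. Let $\Longrightarrow^*$ be the reflexive and transitive closure of the union of the relations $\Longrightarrow_r$, $r\in R$. The generated language is $L(\gamma)=\{w\in T^*\mid x\Longrightarrow^* w\text{ for some }x\in A\}$. The system has rules of size $(n,m,m';p,q,q')$ if every insertion rule $(u,\alpha,v)_{ins}$ in it satisfies $|\alpha|\le n$, $|u|\le m$, $|v|\le m'$ and every deletion rule $(u,\alpha,v)_{del}$ in it satisfies $|\alpha|\le p$, $|u|\le q$, $|v|\le q'$. $SC_{i,j}INS_n^{m,m'}DEL_p^{q,q'}$ denotes the family of languages generated by semi-conditional insertion-deletion systems of degree $(i,j)$ with rules of size $(n,m,m';p,q,q')$. *)

theory Defs
  imports "HOL-Library.Sublist" "HOL-Library.Infinite_Typeclass"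
begin

section \<open>Recursively enumerable languages\<close>

text \<open>
  As is standard in formal language theory, the recursively enumerable languages are the languages
  generated by arbitrary phrase-structure (type-0) grammars. The finite alphabets of grammars and
  systems are subsets of the symbol type \<open>'a\<close>. When \<open>'a\<close> is infinite, every
  finite alphabet can be extended by as many further symbols (e.g. nonterminals) as required.
\<close>

record 'a grammar =
  nonterminals :: "'a set"
  grammar_terminals :: "'a set"
  start_symbol :: 'a
  productions :: "('a list \<times> 'a list) set"

definition type0_grammar :: "'a grammar \<Rightarrow> bool" where
  "type0_grammar G \<longleftrightarrow>
     finite (nonterminals G) \<and> finite (grammar_terminals G) \<and>
     nonterminals G \<inter> grammar_terminals G = {} \<and>
     start_symbol G \<in> nonterminals G \<and>
     finite (productions G) \<and>
     (\<forall>(l, r) \<in> productions G.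
        l \<in> lists (nonterminals G \<union> grammar_terminals G) \<and>
        set l \<inter> nonterminals G \<noteq> {} \<and>
        r \<in> lists (nonterminals G \<union> grammar_terminals G))"

definition grammar_step :: "'a grammar \<Rightarrow> 'a list \<Rightarrow> 'a list \<Rightarrow> bool" where
  "grammar_step G x y \<longleftrightarrow>
     (\<exists>x1 x2 l r. (l, r) \<in> productions G \<and> x = x1 @ l @ x2 \<and> y = x1 @ r @ x2)"

definition grammar_language :: "'a grammar \<Rightarrow> 'a list set" where
  "grammar_language G =
     {w \<in> lists (grammar_terminals G). (grammar_step G)\<^sup>*\<^sup>* [start_symbol G] w}"

definition RE :: "'a list set set" where
  "RE = {grammar_language G | G. type0_grammar G}"

section \<open>Semi-conditional insertion-deletion systems\<close>

datatype insdel_kind = Ins | Del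

record 'a sc_rule =
  kind :: insdel_kind
  left_ctx :: "'a list"
  core :: "'a list"
  right_ctx :: "'a list"
  permitting :: "'a list set"
  forbidding :: "'a list set"

record 'a sc_system =
  alphabet :: "'a set"
  terminals :: "'a set"
  axioms :: "'a list set"
  sc_rules :: "'a sc_rule set"

definition valid_sc_rule :: "nat \<Rightarrow> nat \<Rightarrow> 'a set \<Rightarrow> 'a sc_rule \<Rightarrow> bool" where
  "valid_sc_rule i j V r \<longleftrightarrow>
     left_ctx r \<in> lists V \<and> core r \<in> lists V \<and> right_ctx r \<in> lists V \<and> core r \<noteq> [] \<and>
     finite (permitting r) \<and> (\<forall>x \<in> permitting r. x \<in> lists V \<and> x \<noteq> [] \<and> length x \<le> i) \<and>
     finite (forbidding r) \<and> (\<forall>y \<in> forbidding r. y \<in> lists V \<and> y \<noteq> [] \<and> length y \<le> j)"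

definition sc_system_of_degree :: "nat \<Rightarrow> nat \<Rightarrow> 'a sc_system \<Rightarrow> bool" where
  "sc_system_of_degree i j \<gamma> \<longleftrightarrow>
     i \<ge> 1 \<and> j \<ge> 1 \<and>
     finite (alphabet \<gamma>) \<and> terminals \<gamma> \<subseteq> alphabet \<gamma> \<and>
     finite (axioms \<gamma>) \<and> axioms \<gamma> \<subseteq> lists (alphabet \<gamma>) \<and>
     finite (sc_rules \<gamma>) \<and> (\<forall>r \<in> sc_rules \<gamma>. valid_sc_rule i j (alphabet \<gamma>) r)"

definition ins_step :: "'a list \<Rightarrow> 'a list \<Rightarrow> 'a list \<Rightarrow> 'a list \<Rightarrow> 'a list \<Rightarrow> bool" where
  "ins_step u \<alpha> v x y \<longleftrightarrow>
     (\<exists>x1 x2. x = x1 @ u @ v @ x2 \<and> y = x1 @ u @ \<alpha> @ v @ x2)"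

definition del_step :: "'a list \<Rightarrow> 'a list \<Rightarrow> 'a list \<Rightarrow> 'a list \<Rightarrow> 'a list \<Rightarrow> bool" where
  "del_step u \<alpha> v x y \<longleftrightarrow>
     (\<exists>x1 x2. x = x1 @ u @ \<alpha> @ v @ x2 \<and> y = x1 @ u @ v @ x2)"

definition insdel_step :: "'a sc_rule \<Rightarrow> 'a list \<Rightarrow> 'a list \<Rightarrow> bool" where
  "insdel_step r =
     (case kind r of
        Ins \<Rightarrow> ins_step (left_ctx r) (core r) (right_ctx r)
      | Del \<Rightarrow> del_step (left_ctx r) (core r) (right_ctx r))"

definition sc_rule_step :: "'a sc_rule \<Rightarrow> 'a list \<Rightarrow> 'a list \<Rightarrow> bool" where
  "sc_rule_step r w w' \<longleftrightarrow>
     insdel_step r w w' \<and>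
     (\<forall>x \<in> permitting r. sublist x w) \<and> (\<forall>y \<in> forbidding r. \<not> sublist y w)"

definition sc_step :: "'a sc_system \<Rightarrow> 'a list \<Rightarrow> 'a list \<Rightarrow> bool" where
  "sc_step \<gamma> w w' \<longleftrightarrow>
     w \<in> lists (alphabet \<gamma>) \<and> w' \<in> lists (alphabet \<gamma>) \<and>
     (\<exists>r \<in> sc_rules \<gamma>. sc_rule_step r w w')"

definition sc_language :: "'a sc_system \<Rightarrow> 'a list set" where
  "sc_language \<gamma> =
     {w \<in> lists (terminals \<gamma>). \<exists>x \<in> axioms \<gamma>. (sc_step \<gamma>)\<^sup>*\<^sup>* x w}"

text \<open>A size triple \<open>(n, m, m')\<close> bounds the core, the left context and the right context.\<close>

type_synonym size_triple = "nat \<times> nat \<times> nat"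

definition rule_size_le :: "size_triple \<Rightarrow> 'a sc_rule \<Rightarrow> bool" where
  "rule_size_le = (\<lambda>(n, m, m') r.
     length (core r) \<le> n \<and> length (left_ctx r) \<le> m \<and> length (right_ctx r) \<le> m')"

definition has_rules_of_size :: "size_triple \<Rightarrow> size_triple \<Rightarrow> 'a sc_system \<Rightarrow> bool" where
  "has_rules_of_size ins_size del_size \<gamma> \<longleftrightarrow>
     (\<forall>r \<in> sc_rules \<gamma>.
        (kind r = Ins \<longrightarrow> rule_size_le ins_size r) \<and>
        (kind r = Del \<longrightarrow> rule_size_le del_size r))"

definition SC_INS_DEL :: "nat \<Rightarrow> nat \<Rightarrow> size_triple \<Rightarrow> size_triple \<Rightarrow> 'a list set set" where
  "SC_INS_DEL i j ins_size del_size =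
     {sc_language \<gamma> | \<gamma>. sc_system_of_degree i j \<gamma> \<and> has_rules_of_size ins_size del_size \<gamma>}"

end

theory Submission
  imports Defs
begin

text \<open>
  A grammar simulates a semi-conditional system by sweeping a head over the bracketed word; while
  moving right, the head records the factors of length at most 2 seen so far, which decides the
  permitting and forbidding conditions.

  Conversely, a sentential form \<open>a\<^sub>1 \<dots> a\<^sub>n\<close> is stored as \<open>\<turnstile> a\<^sub>1 # \<dots> a\<^sub>n # \<stileturn>\<close>, and a production is
  applied by a cursor whose name is the list of single-cell edits still to be carried out. One edit
  replaces the cursor \<open>q\<close> by its successor \<open>q'\<close>: insert \<open>q'\<close> anywhere, insert or delete
  the cell \<open>s\<close> anywhere, delete \<open>q\<close>. No rule has a context, so the positions are enforced
  afterwards: the next rule requires the factors \<open>q s\<close> and \<open>s q'\<close>, or \<open>q q'\<close>, and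
  forbids every pair of neighbours that a correct tape does not contain. Because letters and separators
  alternate, an insertion or deletion at a wrong place creates such a pair and the derivation is stuck.
\<close>

section \<open>Renaming of symbols\<close>

text \<open>Both simulations use symbol types of their own, \<open>sim_symbol\<close> and
  \<open>tape\<close>, while the languages are over \<open>'a\<close>. Since \<open>'a\<close> is
  infinite, the finitely many auxiliary symbols can be renamed into it so that every embedded letter
  returns to itself.

  The delicate point is soundness of the cursor system. Without contexts a rule cannot be kept from
  acting at a wrong place; it can only be arranged that nothing applies afterwards. A tape spoilt in
  this way keeps both cursors and so never becomes terminal. What must be excluded is that a further
  rule covers up the mistake: that an edit is repeated, or that the old cursor vanishes before its
  edit is done.

  The end markers are permitting words because their presence gives every inserted or deleted symbol
  a neighbour on both sides, which the forbidden pairs can inspect. Separators and end markers may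
  be erased whenever no cursor is present, hence also between two programs. This does no harm: the
  decoded word depends on the letters alone, and a program erases an encoded left-hand side only
  where it stands contiguously.\<close>

lemma renaming_exists:
  fixes e :: "'a::infinite \<Rightarrow> 'b"
  assumes "finite S" "finite V" "inj e"
  obtains f :: "'b \<Rightarrow> 'a" where "inj_on f S" "\<And>a. a \<in> V \<Longrightarrow> f (e a) = a"
proof -
  have "infinite (UNIV - V)"
    using assms(2) infinite_UNIV by simp
  \<comment> \<open>\<open>B\<close> provides names outside \<open>V\<close> for the symbols of
    \<open>S\<close> that are not embedded letters, so they cannot collide with the letters that
    \<open>f\<close> has to restore.\<close>
  then obtain B where B: "finite B" "card B = card (S - e ` V)" "B \<subseteq> UNIV - V"
    using infinite_arbitrarily_large by metis
  moreover have "finite (S - e ` V)"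
    using assms(1) by simp
  ultimately obtain h where h: "bij_betw h (S - e ` V) B"
    using finite_same_card_bij by metis
  define f where "f x = (if x \<in> e ` V then inv e x else h x)" for x
  have "inj_on f S"
  proof (rule inj_onI)
    fix x y assume xy: "x \<in> S" "y \<in> S" "f x = f y"
    have h_out: "h z \<notin> V" if "z \<in> S" "z \<notin> e ` V" for z
      using h that B(3) bij_betwE by fastforce
    consider "x \<in> e ` V" "y \<in> e ` V" | "x \<notin> e ` V" "y \<notin> e ` V"
      | "x \<in> e ` V" "y \<notin> e ` V" | "x \<notin> e ` V" "y \<in> e ` V" by blast
    then show "x = y"
    proof cases
      case 2
      then show ?thesis
        using xy h by (auto simp: f_def bij_betw_def inj_on_def)
    next
      case 1
      then show ?thesis
        using xy assms(3) by (auto simp: f_def)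
    next
      case 3
      then have "f x \<in> V" "f y \<notin> V"
        using xy h_out assms(3) by (auto simp: f_def)
      then show ?thesis using xy by simp
    next
      case 4
      then have "f x \<notin> V" "f y \<in> V"
        using xy h_out assms(3) by (auto simp: f_def)
      then show ?thesis using xy by simp
    qed
  qed
  moreover have "f (e a) = a" if "a \<in> V" for a
    using that assms(3) by (simp add: f_def)
  ultimately show thesis by (rule that)
qed

lemma map_eq_map_append3:
  assumes "map f x = x1 @ map f l @ x2" "inj_on f S" "x \<in> lists S" "l \<in> lists S"
  obtains y1 y2 where "x = y1 @ l @ y2" "x1 = map f y1" "x2 = map f y2"
proof -
  obtain y1 l' y2 where y: "x = y1 @ l' @ y2" "x1 = map f y1" "map f l = map f l'" "x2 = map f y2"
    using assms(1) by (auto simp: map_eq_append_conv append_eq_map_conv)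
  have "l' = l"
    using y assms by (auto intro!: map_inj_on[of f l' l] inj_on_subset[OF assms(2)])
  with y that show thesis by blast
qed

text \<open>Both directions matter: in whichever direction a step is transported, permitting words
  need one implication and forbidding words the other.\<close>

lemma sublist_map_iff:
  assumes "inj_on f S" "w \<in> lists S" "p \<in> lists S"
  shows "sublist (map f p) (map f w) \<longleftrightarrow> sublist p w"
proof
  assume "sublist (map f p) (map f w)"
  then obtain x1 x2 where "map f w = x1 @ map f p @ x2"
    by (auto simp: sublist_def)
  then show "sublist p w"
    using assms by (metis map_eq_map_append3 sublist_appendI)
next
  assume "sublist p w"
  then obtain x1 x2 where "w = x1 @ p @ x2"
    by (auto simp: sublist_def)
  then show "sublist (map f p) (map f w)"
    by simp
qed

lemma lists_if_map_in_lists: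
  assumes "inj_on f S" "T \<subseteq> S" "w \<in> lists S" "map f w \<in> lists (f ` T)"
  shows "w \<in> lists T"
  using assms by (auto simp: in_lists_conv_set inj_on_image_mem_iff subset_iff)

section \<open>Renaming of grammars\<close>

definition rename_grammar :: "('b \<Rightarrow> 'a) \<Rightarrow> 'b grammar \<Rightarrow> 'a grammar" where
  "rename_grammar f G = \<lparr>nonterminals = f ` nonterminals G,
     grammar_terminals = f ` grammar_terminals G, start_symbol = f (start_symbol G),
     productions = map_prod (map f) (map f) ` productions G\<rparr>"

lemma grammar_step_lists:
  assumes "type0_grammar G" "grammar_step G x y"
    "x \<in> lists (nonterminals G \<union> grammar_terminals G)"
  shows "y \<in> lists (nonterminals G \<union> grammar_terminals G)"
  using assms by (fastforce simp: grammar_step_def type0_grammar_def)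

text \<open>A renaming is injective only on the symbols of the grammar, so a renamed step can be
  pulled back only from a form that stays inside this alphabet.\<close>

lemma grammar_steps_lists:
  assumes "type0_grammar G" "(grammar_step G)\<^sup>*\<^sup>* [start_symbol G] x"
  shows "x \<in> lists (nonterminals G \<union> grammar_terminals G)"
  using assms(2)
proof induction
  case base
  then show ?case using assms(1) by (auto simp: type0_grammar_def)
next
  case (step y z)
  then show ?case using grammar_step_lists[OF assms(1)] by blast
qed

lemma grammar_step_rename:
  assumes "grammar_step G x y"
  shows "grammar_step (rename_grammar f G) (map f x) (map f y)"
proof -
  obtain x1 x2 l r where "(l, r) \<in> productions G" "x = x1 @ l @ x2" "y = x1 @ r @ x2"
    using assms by (auto simp: grammar_step_def)
  then show ?thesis
    unfolding grammar_step_def rename_grammar_def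
    by (intro exI[of _ "map f x1"] exI[of _ "map f x2"] exI[of _ "map f l"] exI[of _ "map f r"])
      (auto intro: rev_image_eqI)
qed

lemma grammar_step_unrename:
  assumes G: "type0_grammar G" and f: "inj_on f (nonterminals G \<union> grammar_terminals G)"
    and x: "x \<in> lists (nonterminals G \<union> grammar_terminals G)"
    and step: "grammar_step (rename_grammar f G) (map f x) z"
  obtains y where "z = map f y" "grammar_step G x y"
proof -
  obtain x1 x2 l r where lr: "(l, r) \<in> productions G"
    "map f x = x1 @ map f l @ x2" "z = x1 @ map f r @ x2"
    using step by (auto simp: grammar_step_def rename_grammar_def)
  have "l \<in> lists (nonterminals G \<union> grammar_terminals G)"
    using G lr by (auto simp: type0_grammar_def)
  then obtain y1 y2 where "x = y1 @ l @ y2" "x1 = map f y1" "x2 = map f y2"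
    using map_eq_map_append3[OF lr(2) f x] by blast
  then show thesis
    using lr that[of "y1 @ r @ y2"] by (auto simp: grammar_step_def)
qed

lemma type0_grammar_rename:
  assumes G: "type0_grammar G" and f: "inj_on f (nonterminals G \<union> grammar_terminals G)"
  shows "type0_grammar (rename_grammar f G)"
proof -
  have "f ` nonterminals G \<inter> f ` grammar_terminals G = {}"
    using G f by (auto simp: type0_grammar_def inj_on_def)
  moreover have "\<forall>x \<in> productions G. case map_prod (map f) (map f) x of (l, r) \<Rightarrow>
      l \<in> lists (f ` nonterminals G \<union> f ` grammar_terminals G) \<and>
      set l \<inter> f ` nonterminals G \<noteq> {} \<and>
      r \<in> lists (f ` nonterminals G \<union> f ` grammar_terminals G)"
  proof
    fix p assume "p \<in> productions G"
    moreover obtain l r where p: "p = (l, r)" by fastforce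
    ultimately have lr: "l \<in> lists (nonterminals G \<union> grammar_terminals G)"
      "set l \<inter> nonterminals G \<noteq> {}" "r \<in> lists (nonterminals G \<union> grammar_terminals G)"
      using G by (auto simp: type0_grammar_def)
    then have "map f l \<in> lists (f ` (nonterminals G \<union> grammar_terminals G))"
      "map f r \<in> lists (f ` (nonterminals G \<union> grammar_terminals G))"
      unfolding lists_image by blast+
    moreover have "set (map f l) \<inter> f ` nonterminals G \<noteq> {}"
      using lr(2) by auto
    ultimately show "case map_prod (map f) (map f) p of (l, r) \<Rightarrow>
      l \<in> lists (f ` nonterminals G \<union> f ` grammar_terminals G) \<and>
      set l \<inter> f ` nonterminals G \<noteq> {} \<and>
      r \<in> lists (f ` nonterminals G \<union> f ` grammar_terminals G)"
      by (simp add: p image_Un)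
  qed
  ultimately show ?thesis
    using G by (simp add: type0_grammar_def rename_grammar_def)
qed

lemma grammar_language_rename:
  assumes G: "type0_grammar G" and f: "inj_on f (nonterminals G \<union> grammar_terminals G)"
  shows "grammar_language (rename_grammar f G) = map f ` grammar_language G"
proof (intro equalityI subsetI)
  let ?S = "nonterminals G \<union> grammar_terminals G"
  fix z assume "z \<in> grammar_language (rename_grammar f G)"
  then have zT: "z \<in> lists (f ` grammar_terminals G)"
    and z: "(grammar_step (rename_grammar f G))\<^sup>*\<^sup>* (map f [start_symbol G]) z"
    by (auto simp: grammar_language_def rename_grammar_def)
  from z obtain w where w: "z = map f w" "(grammar_step G)\<^sup>*\<^sup>* [start_symbol G] w"
  proof (induction arbitrary: thesis)
    case base
    then show ?case by blast
  next
    case (step y z)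
    obtain x where x: "y = map f x" "(grammar_step G)\<^sup>*\<^sup>* [start_symbol G] x"
      using step.IH by blast
    obtain x' where "z = map f x'" "grammar_step G x x'"
      using grammar_step_unrename[OF G f grammar_steps_lists[OF G x(2)]] step.hyps(2) x(1) by blast
    then show ?case
      using x(2) by (intro step.prems[of x']) auto
  qed
  have "w \<in> lists ?S"
    using grammar_steps_lists[OF G w(2)] .
  then have "w \<in> lists (grammar_terminals G)"
    using zT w(1) lists_if_map_in_lists[OF f, of "grammar_terminals G"] by simp
  then show "z \<in> map f ` grammar_language G"
    using w by (auto simp: grammar_language_def)
next
  fix z assume "z \<in> map f ` grammar_language G"
  then obtain w where w: "z = map f w" "w \<in> lists (grammar_terminals G)"
    "(grammar_step G)\<^sup>*\<^sup>* [start_symbol G] w"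
    by (auto simp: grammar_language_def)
  from w(3) have "(grammar_step (rename_grammar f G))\<^sup>*\<^sup>* (map f [start_symbol G]) (map f w)"
    by induction (auto intro: grammar_step_rename rtranclp.rtrancl_into_rtrancl)
  then show "z \<in> grammar_language (rename_grammar f G)"
    using w by (auto simp: grammar_language_def rename_grammar_def)
qed

section \<open>Renaming of semi-conditional systems\<close>

definition rename_rule :: "('b \<Rightarrow> 'a) \<Rightarrow> 'b sc_rule \<Rightarrow> 'a sc_rule" where
  "rename_rule f r = \<lparr>kind = kind r, left_ctx = map f (left_ctx r), core = map f (core r),
     right_ctx = map f (right_ctx r), permitting = map f ` permitting r,
     forbidding = map f ` forbidding r\<rparr>"

definition rename_system :: "('b \<Rightarrow> 'a) \<Rightarrow> 'b sc_system \<Rightarrow> 'a sc_system" where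
  "rename_system f \<gamma> = \<lparr>alphabet = f ` alphabet \<gamma>, terminals = f ` terminals \<gamma>,
     axioms = map f ` axioms \<gamma>, sc_rules = rename_rule f ` sc_rules \<gamma>\<rparr>"

lemma sc_system_of_degree_rename:
  assumes "sc_system_of_degree i j \<gamma>"
  shows "sc_system_of_degree i j (rename_system f \<gamma>)"
proof -
  have map_lists: "map f x \<in> lists (f ` V)" if "x \<in> lists V" for x V
    using that unfolding lists_image by blast
  have "valid_sc_rule i j (f ` V) (rename_rule f r)" if "valid_sc_rule i j V r" for V r
    using that map_lists[of _ V] unfolding valid_sc_rule_def rename_rule_def by simp
  moreover have "map f ` axioms \<gamma> \<subseteq> lists (f ` alphabet \<gamma>)"
    using assms unfolding lists_image by (simp add: sc_system_of_degree_def image_mono)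
  ultimately show ?thesis
    using assms by (simp add: sc_system_of_degree_def rename_system_def image_mono)
qed

lemma has_rules_of_size_rename:
  assumes "has_rules_of_size s t \<gamma>"
  shows "has_rules_of_size s t (rename_system f \<gamma>)"
  using assms
  by (auto simp: has_rules_of_size_def rename_system_def rename_rule_def rule_size_le_def
      split: prod.splits)

lemma sc_rule_step_rename:
  assumes r: "valid_sc_rule i j V r" and f: "inj_on f V" and x: "x \<in> lists V"
    and step: "sc_rule_step r x y"
  shows "sc_rule_step (rename_rule f r) (map f x) (map f y)"
proof -
  have "insdel_step (rename_rule f r) (map f x) (map f y)"
    using step unfolding sc_rule_step_def insdel_step_def rename_rule_def ins_step_def del_step_def
    by (cases "kind r") (auto, (metis map_append)+)
  then show ?thesis
    using step r sublist_map_iff[OF f x]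
    by (auto simp: sc_rule_step_def rename_rule_def valid_sc_rule_def)
qed

lemma sc_rule_step_unrename:
  assumes r: "valid_sc_rule i j V r" and f: "inj_on f V" and x: "x \<in> lists V"
    and step: "sc_rule_step (rename_rule f r) (map f x) z"
  obtains y where "z = map f y" "y \<in> lists V" "sc_rule_step r x y"
proof -
  have conds: "(\<forall>p \<in> permitting r. sublist p x) \<and> (\<forall>p \<in> forbidding r. \<not> sublist p x)"
    using step r sublist_map_iff[OF f x]
    by (auto simp: sc_rule_step_def rename_rule_def valid_sc_rule_def)
  have ctx: "left_ctx r \<in> lists V" "core r \<in> lists V" "right_ctx r \<in> lists V"
    using r by (auto simp: valid_sc_rule_def)
  show thesis
  proof (cases "kind r")
    case Ins
    then obtain x1 x2 where e: "map f x = x1 @ map f (left_ctx r @ right_ctx r) @ x2"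
      "z = x1 @ map f (left_ctx r @ core r @ right_ctx r) @ x2"
      using step by (auto simp: sc_rule_step_def insdel_step_def rename_rule_def ins_step_def)
    moreover have "left_ctx r @ right_ctx r \<in> lists V"
      using ctx by simp
    ultimately obtain y1 y2 where y: "x = y1 @ (left_ctx r @ right_ctx r) @ y2"
      "x1 = map f y1" "x2 = map f y2"
      using map_eq_map_append3[OF e(1) f x] by blast
    show thesis
    proof (rule that)
      show "z = map f (y1 @ (left_ctx r @ core r @ right_ctx r) @ y2)"
        using e y by simp
      show "y1 @ (left_ctx r @ core r @ right_ctx r) @ y2 \<in> lists V"
        using y ctx x by simp
      show "sc_rule_step r x (y1 @ (left_ctx r @ core r @ right_ctx r) @ y2)"
        using conds y Ins by (auto simp: sc_rule_step_def insdel_step_def ins_step_def)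
    qed
  next
    case Del
    then obtain x1 x2 where e: "map f x = x1 @ map f (left_ctx r @ core r @ right_ctx r) @ x2"
      "z = x1 @ map f (left_ctx r @ right_ctx r) @ x2"
      using step by (auto simp: sc_rule_step_def insdel_step_def rename_rule_def del_step_def)
    moreover have "left_ctx r @ core r @ right_ctx r \<in> lists V"
      using ctx by simp
    ultimately obtain y1 y2 where y: "x = y1 @ (left_ctx r @ core r @ right_ctx r) @ y2"
      "x1 = map f y1" "x2 = map f y2"
      using map_eq_map_append3[OF e(1) f x] by blast
    show thesis
    proof (rule that)
      show "z = map f (y1 @ (left_ctx r @ right_ctx r) @ y2)"
        using e y by simp
      show "y1 @ (left_ctx r @ right_ctx r) @ y2 \<in> lists V"
        using y ctx x by simp
      show "sc_rule_step r x (y1 @ (left_ctx r @ right_ctx r) @ y2)"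
        using conds y Del by (auto simp: sc_rule_step_def insdel_step_def del_step_def)
    qed
  qed
qed

lemma sc_steps_lists:
  assumes "sc_system_of_degree i j \<gamma>" "x \<in> axioms \<gamma>" "(sc_step \<gamma>)\<^sup>*\<^sup>* x w"
  shows "w \<in> lists (alphabet \<gamma>)"
  using assms(3)
proof cases
  case rtrancl_refl
  then show ?thesis using assms(1,2) by (auto simp: sc_system_of_degree_def)
next
  case (rtrancl_into_rtrancl y)
  then show ?thesis by (simp add: sc_step_def)
qed

lemma sc_language_rename:
  assumes \<gamma>: "sc_system_of_degree i j \<gamma>" and f: "inj_on f (alphabet \<gamma>)"
  shows "sc_language (rename_system f \<gamma>) = map f ` sc_language \<gamma>"
proof (intro equalityI subsetI)
  have valid: "valid_sc_rule i j (alphabet \<gamma>) r" if "r \<in> sc_rules \<gamma>" for r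
    using \<gamma> that by (auto simp: sc_system_of_degree_def)
  {
    fix z assume "z \<in> sc_language (rename_system f \<gamma>)"
    then obtain x where zT: "z \<in> lists (f ` terminals \<gamma>)" and x: "x \<in> axioms \<gamma>"
      and z: "(sc_step (rename_system f \<gamma>))\<^sup>*\<^sup>* (map f x) z"
      by (auto simp: sc_language_def rename_system_def)
    from z obtain w where w: "z = map f w" "(sc_step \<gamma>)\<^sup>*\<^sup>* x w"
    proof (induction arbitrary: thesis)
      case base
      then show ?case by blast
    next
      case (step y z)
      obtain u where u: "y = map f u" "(sc_step \<gamma>)\<^sup>*\<^sup>* x u"
        using step.IH by blast
      have uV: "u \<in> lists (alphabet \<gamma>)"
        using sc_steps_lists[OF \<gamma> x u(2)] .
      obtain r where r: "r \<in> sc_rules \<gamma>" "sc_rule_step (rename_rule f r) (map f u) z"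
        using step.hyps(2) u(1) by (auto simp: sc_step_def rename_system_def)
      obtain v where "z = map f v" "v \<in> lists (alphabet \<gamma>)" "sc_rule_step r u v"
        using sc_rule_step_unrename[OF valid[OF r(1)] f uV r(2)] by blast
      then have "z = map f v" "sc_step \<gamma> u v"
        using uV r(1) unfolding sc_step_def by auto
      then show ?case
        using u(2) by (intro step.prems[of v]) auto
    qed
    have "w \<in> lists (alphabet \<gamma>)"
      using sc_steps_lists[OF \<gamma> x w(2)] .
    moreover have "terminals \<gamma> \<subseteq> alphabet \<gamma>"
      using \<gamma> by (simp add: sc_system_of_degree_def)
    ultimately have "w \<in> lists (terminals \<gamma>)"
      using zT w(1) lists_if_map_in_lists[OF f] by simp
    then show "z \<in> map f ` sc_language \<gamma>"
      using w x by (auto simp: sc_language_def)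
  next
    fix z assume "z \<in> map f ` sc_language \<gamma>"
    then obtain x w where w: "z = map f w" "w \<in> lists (terminals \<gamma>)" "x \<in> axioms \<gamma>"
      "(sc_step \<gamma>)\<^sup>*\<^sup>* x w"
      by (auto simp: sc_language_def)
    have step: "sc_step (rename_system f \<gamma>) (map f u) (map f v)" if "sc_step \<gamma> u v" for u v
      using that sc_rule_step_rename[OF valid f] unfolding sc_step_def rename_system_def by auto
    from w(4) have "(sc_step (rename_system f \<gamma>))\<^sup>*\<^sup>* (map f x) (map f w)"
      by induction (auto intro: step rtranclp.rtrancl_into_rtrancl)
    then show "z \<in> sc_language (rename_system f \<gamma>)"
      using w by (auto simp: sc_language_def rename_system_def)
  }
qed

section \<open>Simulation of semi-conditional systems by grammars\<close>

definition enabled :: "'a sc_rule \<Rightarrow> 'a list \<Rightarrow> bool" where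
  "enabled r w \<longleftrightarrow>
     (\<forall>x \<in> permitting r. sublist x w) \<and> (\<forall>y \<in> forbidding r. \<not> sublist y w)"

lemma sc_rule_step_single:
  assumes "left_ctx r = []" "right_ctx r = []" "core r = [c]"
  shows "sc_rule_step r w w' \<longleftrightarrow> enabled r w \<and>
    (\<exists>x y. kind r = Ins \<and> w = x @ y \<and> w' = x @ c # y \<or> kind r = Del \<and> w = x @ c # y \<and> w' = x @ y)"
  using assms
  by (cases "kind r")
    (auto simp: sc_rule_step_def enabled_def insdel_step_def ins_step_def del_step_def)

lemma size_1_0_0_rule:
  assumes "sc_system_of_degree i j \<gamma>" "has_rules_of_size (1, 0, 0) (1, 0, 0) \<gamma>" "r \<in> sc_rules \<gamma>"
  obtains c where "left_ctx r = []" "right_ctx r = []" "core r = [c]" "c \<in> alphabet \<gamma>"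
proof -
  have "rule_size_le (1, 0, 0) r"
    using assms(2,3) by (cases "kind r") (auto simp: has_rules_of_size_def)
  moreover have "core r \<noteq> []" "core r \<in> lists (alphabet \<gamma>)"
    using assms(1,3) by (auto simp: sc_system_of_degree_def valid_sc_rule_def)
  ultimately show thesis
    using that by (cases "core r") (auto simp: rule_size_le_def)
qed

text \<open>A finite-state summary of a word that determines which conditions of degree 2 it satisfies:
  the suffixes are what is needed to update the factors when a letter is appended.\<close>

definition summary :: "'a list \<Rightarrow> 'a list set \<times> 'a list set" where
  "summary u = ({x. sublist x u \<and> length x \<le> 2}, {x. suffix x u \<and> length x \<le> 1})"

text \<open>A factor of \<open>u @ [a]\<close> is a factor of \<open>u\<close> or a suffix of
  \<open>u @ [a]\<close>, and a nonempty suffix of length at most 2 is a suffix of \<open>u\<close>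
  of length at most 1 followed by \<open>a\<close>. Thus a summary behaves like the state of a
  finite automaton.\<close>

lemma summary_snoc_cong:
  assumes "summary u = summary u'"
  shows "summary (u @ [a]) = summary (u' @ [a])"
proof -
  have suf: "suffix x u \<longleftrightarrow> suffix x u'" if "length x \<le> 1" for x
    using assms that by (auto simp: summary_def)
  have sub: "sublist x u \<longleftrightarrow> sublist x u'" if "length x \<le> 2" for x
    using assms that by (auto simp: summary_def)
  have suf2: "suffix x (u @ [a]) \<longleftrightarrow> suffix x (u' @ [a])" if "length x \<le> 2" for x
    using suf that by auto
  have "sublist x (u @ [a]) \<longleftrightarrow> sublist x (u' @ [a])" if "length x \<le> 2" for x
    using suf2[OF that] sub[OF that] by (simp only: sublist_snoc)
  then show ?thesis
    unfolding summary_def using suf2 by auto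
qed

lemma enabled_summary_cong:
  assumes "valid_sc_rule 2 2 V r" "summary u = summary u'"
  shows "enabled r u \<longleftrightarrow> enabled r u'"
proof -
  have "sublist x u \<longleftrightarrow> sublist x u'" if "x \<in> permitting r \<union> forbidding r" for x
    using assms that by (auto simp: summary_def valid_sc_rule_def)
  then show ?thesis
    by (auto simp: enabled_def)
qed

lemma finite_summaries:
  assumes "finite V"
  shows "finite (summary ` lists V)"
proof (rule finite_subset)
  let ?X = "{x. set x \<subseteq> V \<and> length x \<le> 2}"
  show "summary ` lists V \<subseteq> Pow ?X \<times> Pow ?X"
    by (fastforce simp: summary_def dest: set_mono_sublist set_mono_suffix)
  show "finite (Pow ?X \<times> Pow ?X)"
    using finite_lists_length_le[OF assms] by simp
qed

section \<open>The simulating grammar\<close>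

datatype 'a sim_symbol =
    Tape 'a | LeftMark | RightMark | Start
  | Scan "'a list set \<times> 'a list set" | Apply "'a sc_rule" | Return | Finish

fun is_head :: "'a sim_symbol \<Rightarrow> bool" where
  "is_head (Tape _) = False" | "is_head LeftMark = False" | "is_head RightMark = False"
| "is_head _ = True"

text \<open>A word with a single head can match a left-hand side containing a head only at that
  place, so the invariant proof need not search for positions.\<close>

lemma head_unique:
  assumes "pre @ h # post = x1 @ (l1 @ h' # l2) @ x2" "\<forall>s \<in> set pre \<union> set post. \<not> is_head s"
    "is_head h'"
  shows "h = h' \<and> pre = x1 @ l1 \<and> post = l2 @ x2"
proof -
  have "pre @ h # post = (x1 @ l1) @ h' # (l2 @ x2)"
    using assms(1) by simp
  then obtain us where "pre = (x1 @ l1) @ us \<and> us @ h # post = h' # (l2 @ x2) \<or>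
      pre @ us = x1 @ l1 \<and> h # post = us @ h' # (l2 @ x2)"
    unfolding append_eq_append_conv2 by blast
  then show ?thesis
    using assms(2,3) by (cases us) auto
qed

locale single_symbol_system =
  fixes \<gamma> :: "'a sc_system"
  assumes degree: "sc_system_of_degree 2 2 \<gamma>"
    and size: "has_rules_of_size (1, 0, 0) (1, 0, 0) \<gamma>"
begin

text \<open>In \<open>scan\<close> and \<open>select\<close> the word \<open>u\<close> merely
  represents its summary; it need not be the prefix that was read. \<open>select\<close> commits to
  a rule at the right end, where the summary covers the whole word; the position is chosen
  afterwards, while \<open>Apply r\<close> travels left.\<close>

inductive production :: "'a sim_symbol list \<Rightarrow> 'a sim_symbol list \<Rightarrow> bool" where
  start: "x \<in> axioms \<gamma> \<Longrightarrow>
    production [Start] ([LeftMark, Scan (summary [])] @ map Tape x @ [RightMark])"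
| scan: "u \<in> lists (alphabet \<gamma>) \<Longrightarrow> a \<in> alphabet \<gamma> \<Longrightarrow>
    production [Scan (summary u), Tape a] [Tape a, Scan (summary (u @ [a]))]"
| select: "u \<in> lists (alphabet \<gamma>) \<Longrightarrow> r \<in> sc_rules \<gamma> \<Longrightarrow> enabled r u \<Longrightarrow>
    production [Scan (summary u), RightMark] [Apply r, RightMark]"
| apply_left: "a \<in> alphabet \<gamma> \<Longrightarrow> r \<in> sc_rules \<gamma> \<Longrightarrow>
    production [Tape a, Apply r] [Apply r, Tape a]"
| insert: "r \<in> sc_rules \<gamma> \<Longrightarrow> kind r = Ins \<Longrightarrow> core r = [c] \<Longrightarrow>
    production [Apply r] [Tape c, Return]"
| delete: "r \<in> sc_rules \<gamma> \<Longrightarrow> kind r = Del \<Longrightarrow> core r = [c] \<Longrightarrow>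
    production [Apply r, Tape c] [Return]"
| return_left: "a \<in> alphabet \<gamma> \<Longrightarrow> production [Tape a, Return] [Return, Tape a]"
| restart: "production [LeftMark, Return] [LeftMark, Scan (summary [])]"
| finish: "production [LeftMark, Scan (summary [])] [Finish]"
| finish_right: "a \<in> alphabet \<gamma> \<Longrightarrow> production [Finish, Tape a] [Tape a, Finish]"
| stop: "production [Finish, RightMark] []"

text \<open>All nonterminals other than tape letters; the two marks are included although
  \<open>is_head\<close> rejects them.\<close>

definition heads :: "'a sim_symbol set" where
  "heads = {LeftMark, RightMark, Start, Return, Finish} \<union>
     Scan ` summary ` lists (alphabet \<gamma>) \<union> Apply ` sc_rules \<gamma>"

definition simulation :: "'a sim_symbol grammar" where
  "simulation = \<lparr>nonterminals = heads \<union> Tape ` (alphabet \<gamma> - terminals \<gamma>),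
     grammar_terminals = Tape ` terminals \<gamma>, start_symbol = Start,
     productions = {(l, r). production l r}\<rparr>"

lemma finite_alphabet: "finite (alphabet \<gamma>)"
  and finite_axioms: "finite (axioms \<gamma>)"
  and finite_rules: "finite (sc_rules \<gamma>)"
  and axiom_lists: "x \<in> axioms \<gamma> \<Longrightarrow> x \<in> lists (alphabet \<gamma>)"
  and terminals_subset: "terminals \<gamma> \<subseteq> alphabet \<gamma>"
  and valid_rule: "r \<in> sc_rules \<gamma> \<Longrightarrow> valid_sc_rule 2 2 (alphabet \<gamma>) r"
  using degree by (auto simp: sc_system_of_degree_def)

lemma simulation_symbols:
  "nonterminals simulation \<union> grammar_terminals simulation = heads \<union> Tape ` alphabet \<gamma>"
  using terminals_subset by (auto simp: simulation_def)

lemma summary_heads: "u \<in> lists (alphabet \<gamma>) \<Longrightarrow> Scan (summary u) \<in> heads"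
  by (simp add: heads_def)

lemma core_alphabet: "r \<in> sc_rules \<gamma> \<Longrightarrow> core r = [c] \<Longrightarrow> c \<in> alphabet \<gamma>"
  using valid_rule by (fastforce simp: valid_sc_rule_def)

lemma production_lists:
  assumes "production l r"
  shows "l \<in> lists (heads \<union> Tape ` alphabet \<gamma>) \<and> r \<in> lists (heads \<union> Tape ` alphabet \<gamma>) \<and>
    length l \<le> 2 \<and> (\<exists>h \<in> set l. is_head h)"
  using assms
proof cases
  case (start x)
  then show ?thesis
    using axiom_lists[of x] by (auto simp: heads_def)
next
  case (scan u a)
  then show ?thesis
    using summary_heads[of u] summary_heads[of "u @ [a]"] by auto
next
  case (select u r)
  then show ?thesis
    using summary_heads[of u] by (auto simp: heads_def)
qed (use core_alphabet in \<open>auto simp: heads_def\<close>)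

lemma type0_simulation: "type0_grammar simulation"
proof -
  let ?S = "heads \<union> Tape ` alphabet \<gamma>"
  have "finite heads"
    unfolding heads_def using finite_rules finite_summaries[OF finite_alphabet] by simp
  then have fin: "finite ?S"
    using finite_alphabet by simp
  let ?P = "{x. set x \<subseteq> ?S \<and> length x \<le> 2}"
  let ?I = "(\<lambda>x. ([Start], [LeftMark, Scan (summary [])] @ map Tape x @ [RightMark])) ` axioms \<gamma>"
  \<comment> \<open>Only start productions have a side longer than two symbols, and they are indexed
    by the finitely many axioms. All others are pairs of short words over a finite set.\<close>
  have "(l, r) \<in> ?I \<union> ?P \<times> ?P" if "production l r" for l r
    using that
  proof cases
    case (start x)
    then show ?thesis by blast
  qed (use production_lists[OF that] in auto)
  then have "{(l, r). production l r} \<subseteq> ?I \<union> ?P \<times> ?P"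
    by blast
  moreover have "finite (?I \<union> ?P \<times> ?P)"
    using finite_lists_length_le[OF fin] finite_axioms by simp
  ultimately have "finite (productions simulation)"
    unfolding simulation_def by (simp add: finite_subset)
  moreover have "set l \<inter> nonterminals simulation \<noteq> {}" if p: "production l r" for l r
  proof -
    obtain h where "h \<in> set l" "is_head h"
      using production_lists[OF p] by blast
    moreover have "h \<in> ?S"
      using calculation production_lists[OF p] by auto
    ultimately show ?thesis
      by (auto simp: simulation_def)
  qed
  moreover have "nonterminals simulation \<inter> grammar_terminals simulation = {}"
    by (auto simp: simulation_def heads_def)
  moreover have "finite (nonterminals simulation)" "finite (grammar_terminals simulation)"
    using fin unfolding simulation_symbols[symmetric] by simp_all
  moreover have "start_symbol simulation \<in> nonterminals simulation"
    by (simp add: simulation_def heads_def)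
  moreover have "(l, r) \<in> productions simulation \<longleftrightarrow> production l r" for l r
    by (simp add: simulation_def)
  ultimately show ?thesis
    using production_lists unfolding type0_grammar_def simulation_symbols by blast
qed

section \<open>The invariant of derivations in the simulating grammar\<close>

definition reachable :: "'a list \<Rightarrow> bool" where
  "reachable w \<longleftrightarrow> (\<exists>x \<in> axioms \<gamma>. (sc_step \<gamma>)\<^sup>*\<^sup>* x w)"

lemma reachable_lists: "reachable w \<Longrightarrow> w \<in> lists (alphabet \<gamma>)"
  using sc_steps_lists[OF degree] by (auto simp: reachable_def)

lemma reachable_insert:
  assumes "reachable (x @ y)" "r \<in> sc_rules \<gamma>" "enabled r (x @ y)" "kind r = Ins" "core r = [c]"
  shows "reachable (x @ c # y)"
proof -
  have "left_ctx r = [] \<and> right_ctx r = []"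
    using size_1_0_0_rule[OF degree size assms(2)] by blast
  then have "sc_rule_step r (x @ y) (x @ c # y)"
    using assms sc_rule_step_single[of r c] by blast
  then have "sc_step \<gamma> (x @ y) (x @ c # y)"
    using assms reachable_lists[OF assms(1)] core_alphabet[OF assms(2,5)]
    by (auto simp: sc_step_def)
  then show ?thesis
    using assms(1) unfolding reachable_def by (meson rtranclp.rtrancl_into_rtrancl)
qed

lemma reachable_delete:
  assumes "reachable (x @ c # y)" "r \<in> sc_rules \<gamma>" "enabled r (x @ c # y)" "kind r = Del" "core r = [c]"
  shows "reachable (x @ y)"
proof -
  have "left_ctx r = [] \<and> right_ctx r = []"
    using size_1_0_0_rule[OF degree size assms(2)] by blast
  then have "sc_rule_step r (x @ c # y) (x @ y)"
    using assms sc_rule_step_single[of r c] by blast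
  then have "sc_step \<gamma> (x @ c # y) (x @ y)"
    using assms reachable_lists[OF assms(1)] by (auto simp: sc_step_def)
  then show ?thesis
    using assms(1) unfolding reachable_def by (meson rtranclp.rtrancl_into_rtrancl)
qed

text \<open>\<open>Scan\<close> carries the summary of exactly the prefix to its left.
  \<open>Apply r\<close> remembers that \<open>r\<close> was enabled on the whole word, so any
  position it reaches is legitimate. A \<open>result\<close> has no head and therefore admits no
  production.\<close>

inductive config :: "'a sim_symbol list \<Rightarrow> bool" where
  start: "config [Start]"
| scan: "reachable (u @ v) \<Longrightarrow>
    config ((LeftMark # map Tape u) @ Scan (summary u) # (map Tape v @ [RightMark]))"
| applying: "reachable (u @ v) \<Longrightarrow> r \<in> sc_rules \<gamma> \<Longrightarrow> enabled r (u @ v) \<Longrightarrow>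
    config ((LeftMark # map Tape u) @ Apply r # (map Tape v @ [RightMark]))"
| return: "reachable (u @ v) \<Longrightarrow>
    config ((LeftMark # map Tape u) @ Return # (map Tape v @ [RightMark]))"
| finish: "reachable (u @ v) \<Longrightarrow> config (map Tape u @ Finish # (map Tape v @ [RightMark]))"
| result: "reachable w \<Longrightarrow> config (map Tape w)"

text \<open>A case rule: the head occurring in a left-hand side selects the kind of configuration
  and fixes what surrounds the match. \<open>result\<close> drops out for lack of a head.\<close>

lemma config_head:
  assumes "config z" "z = x1 @ (l1 @ h # l2) @ x2" "is_head h"
  obtains "h = Start" "x1 = []" "l1 = []" "l2 = []" "x2 = []"
  | u v where "reachable (u @ v)" "h = Scan (summary u)" "x1 @ l1 = LeftMark # map Tape u"
      "l2 @ x2 = map Tape v @ [RightMark]"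
  | u v r where "reachable (u @ v)" "r \<in> sc_rules \<gamma>" "enabled r (u @ v)" "h = Apply r"
      "x1 @ l1 = LeftMark # map Tape u" "l2 @ x2 = map Tape v @ [RightMark]"
  | u v where "reachable (u @ v)" "h = Return" "x1 @ l1 = LeftMark # map Tape u"
      "l2 @ x2 = map Tape v @ [RightMark]"
  | u v where "reachable (u @ v)" "h = Finish" "x1 @ l1 = map Tape u"
      "l2 @ x2 = map Tape v @ [RightMark]"
  using assms(1)
proof cases
  case start
  then have "[] @ Start # [] = x1 @ (l1 @ h # l2) @ x2"
    using assms(2) by simp
  from head_unique[OF this _ assms(3)] show thesis
    using that(1) by simp
next
  case (scan u v)
  note eq = trans[OF scan(1)[symmetric] assms(2)]
  show thesis
    using head_unique[OF eq _ assms(3)] that(2) scan(2) by fastforce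
next
  case (applying u v r)
  note eq = trans[OF applying(1)[symmetric] assms(2)]
  show thesis
    using head_unique[OF eq _ assms(3)] that(3) applying(2-) by fastforce
next
  case (return u v)
  note eq = trans[OF return(1)[symmetric] assms(2)]
  show thesis
    using head_unique[OF eq _ assms(3)] that(4) return(2) by fastforce
next
  case (finish u v)
  note eq = trans[OF finish(1)[symmetric] assms(2)]
  show thesis
    using head_unique[OF eq _ assms(3)] that(5) finish(2) by fastforce
next
  case (result w)
  have "h \<in> set (map Tape w)"
    unfolding result(1)[symmetric] assms(2) by simp
  then show thesis
    using assms(3) by auto
qed

lemma config_step:
  assumes "config z" "grammar_step simulation z z'"
  shows "config z'"
proof -
  obtain x1 x2 l r where p: "production l r" and z: "z = x1 @ l @ x2" and z': "z' = x1 @ r @ x2"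
    using assms(2) by (auto simp: grammar_step_def simulation_def)
  note head = config_head[OF assms(1), consumes 2, case_names 1 2 3 4 5]
  show ?thesis
    using p
  proof cases
    case (start x)
    have "z = x1 @ ([] @ Start # []) @ x2" "is_head (Start)"
      using z start by simp_all
    then show ?thesis
    proof (cases rule: head)
      case 1
      have "reachable ([] @ x)"
        using start by (auto simp: reachable_def)
      from config.scan[OF this] show ?thesis
        using 1 start z' by simp
    qed auto
  next
    case (scan u0 a)
    have "z = x1 @ ([] @ Scan (summary u0) # [Tape a]) @ x2" "is_head (Scan (summary u0))"
      using z scan by simp_all
    then show ?thesis
    proof (cases rule: head)
      case (2 u v)
      then obtain v' where v: "v = a # v'" "x2 = map Tape v' @ [RightMark]"
        by (cases v) auto
      \<comment> \<open>The production was built from the representative \<open>u0\<close>, whereas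
        the invariant speaks of the prefix \<open>u\<close> actually read.\<close>
      have "summary (u0 @ [a]) = summary (u @ [a])"
        using 2 by (intro summary_snoc_cong) auto
      with config.scan[of "u @ [a]" v'] show ?thesis
        using 2 v scan z' by simp
    qed auto
  next
    case (select u0 r0)
    have "z = x1 @ ([] @ Scan (summary u0) # [RightMark]) @ x2" "is_head (Scan (summary u0))"
      using z select by simp_all
    then show ?thesis
    proof (cases rule: head)
      case (2 u v)
      then have v: "v = []" "x2 = []"
        by (cases v; auto)+
      have "enabled r0 u"
        using enabled_summary_cong[OF valid_rule[OF select(4)], of u0 u] 2 select by simp
      with config.applying[of u "[]" r0] show ?thesis
        using 2 v select z' by simp
    qed auto
  next
    case (apply_left a r0)
    have "z = x1 @ ([Tape a] @ Apply r0 # []) @ x2" "is_head (Apply r0)"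
      using z apply_left by simp_all
    then show ?thesis
    proof (cases rule: head)
      case (3 u v r1)
      then obtain u' where u: "u = u' @ [a]" "x1 = LeftMark # map Tape u'"
        by (cases u rule: rev_cases) auto
      with config.applying[of u' "a # v" r0] show ?thesis
        using 3 apply_left z' by simp
    qed auto
  next
    case (insert r0 c)
    have "z = x1 @ ([] @ Apply r0 # []) @ x2" "is_head (Apply r0)"
      using z insert by simp_all
    then show ?thesis
    proof (cases rule: head)
      case (3 u v r1)
      then have "reachable (u @ c # v)"
        using reachable_insert[of u v r0 c] insert by simp
      with config.return[of "u @ [c]" v] show ?thesis
        using 3 insert z' by simp
    qed auto
  next
    case (delete r0 c)
    have "z = x1 @ ([] @ Apply r0 # [Tape c]) @ x2" "is_head (Apply r0)"
      using z delete by simp_all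
    then show ?thesis
    proof (cases rule: head)
      case (3 u v r1)
      then obtain v' where v: "v = c # v'" "x2 = map Tape v' @ [RightMark]"
        by (cases v) auto
      then have "reachable (u @ v')"
        using 3 reachable_delete[of u c v' r0] delete by simp
      with config.return[of u v'] show ?thesis
        using 3 v delete z' by simp
    qed auto
  next
    case (return_left a)
    have "z = x1 @ ([Tape a] @ Return # []) @ x2" "is_head (Return)"
      using z return_left by simp_all
    then show ?thesis
    proof (cases rule: head)
      case (4 u v)
      then obtain u' where u: "u = u' @ [a]" "x1 = LeftMark # map Tape u'"
        by (cases u rule: rev_cases) auto
      with config.return[of u' "a # v"] show ?thesis
        using 4 return_left z' by simp
    qed auto
  next
    case restart
    have "z = x1 @ ([LeftMark] @ Return # []) @ x2" "is_head (Return)"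
      using z restart by simp_all
    then show ?thesis
    proof (cases rule: head)
      case (4 u v)
      then have u: "u = []" "x1 = []"
        by (cases u rule: rev_cases; auto)+
      with config.scan[of "[]" v] show ?thesis
        using 4 restart z' by simp
    qed auto
  next
    case finish
    have "z = x1 @ ([LeftMark] @ Scan (summary []) # []) @ x2" "is_head (Scan (summary []))"
      using z finish by simp_all
    then show ?thesis
    proof (cases rule: head)
      case (2 u v)
      have u: "u = []" "x1 = []"
        using 2(3) by (cases u rule: rev_cases; auto)+
      with config.finish[of "[]" v] show ?thesis
        using 2 finish z' by simp
    qed auto
  next
    case (finish_right a)
    have "z = x1 @ ([] @ Finish # [Tape a]) @ x2" "is_head (Finish)"
      using z finish_right by simp_all
    then show ?thesis
    proof (cases rule: head)
      case (5 u v)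
      then obtain v' where v: "v = a # v'" "x2 = map Tape v' @ [RightMark]"
        by (cases v) auto
      with config.finish[of "u @ [a]" v'] show ?thesis
        using 5 finish_right z' by simp
    qed auto
  next
    case stop
    have "z = x1 @ ([] @ Finish # [RightMark]) @ x2" "is_head (Finish)"
      using z stop by simp_all
    then show ?thesis
    proof (cases rule: head)
      case (5 u v)
      then have "v = []" "x2 = []"
        by (cases v; auto)+
      with config.result[of u] show ?thesis
        using 5 stop z' by simp
    qed auto
  qed
qed

section \<open>Grammar derivations that carry out steps of the system\<close>

lemma simulation_step:
  assumes "production l r"
  shows "grammar_step simulation (x1 @ l @ x2) (x1 @ r @ x2)"
  using assms by (auto simp: grammar_step_def simulation_def)

abbreviation derives (infix "\<turnstile>" 50) where
  "x \<turnstile> y \<equiv> (grammar_step simulation)\<^sup>*\<^sup>* x y"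

lemma scan_right:
  assumes "u @ v \<in> lists (alphabet \<gamma>)"
  shows "LeftMark # map Tape u @ Scan (summary u) # map Tape v @ [RightMark] \<turnstile>
    LeftMark # map Tape (u @ v) @ [Scan (summary (u @ v)), RightMark]"
  using assms
proof (induction v arbitrary: u)
  case (Cons a v)
  have "production [Scan (summary u), Tape a] [Tape a, Scan (summary (u @ [a]))]"
    using Cons.prems by (intro production.scan) auto
  from simulation_step[OF this, of "LeftMark # map Tape u" "map Tape v @ [RightMark]"]
  show ?case
    using Cons.IH[of "u @ [a]"] Cons.prems by (simp add: converse_rtranclp_into_rtranclp)
qed simp

text \<open>Stated for any head \<open>h\<close> because \<open>Apply r\<close> and
  \<open>Return\<close> both travel left.\<close>

lemma move_left:
  assumes "\<And>a. a \<in> alphabet \<gamma> \<Longrightarrow> production [Tape a, h] [h, Tape a]" "v \<in> lists (alphabet \<gamma>)"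
  shows "x @ map Tape v @ h # post \<turnstile> x @ h # map Tape v @ post"
  using assms(2)
proof (induction v arbitrary: post rule: rev_induct)
  case (snoc a v)
  have "production [Tape a, h] [h, Tape a]"
    using snoc.prems assms(1) by simp
  from simulation_step[OF this, of "x @ map Tape v" post]
  show ?case
    using snoc.IH[of "Tape a # post"] snoc.prems by (simp add: converse_rtranclp_into_rtranclp)
qed simp

lemma finish_right:
  assumes "v \<in> lists (alphabet \<gamma>)"
  shows "map Tape u @ Finish # map Tape v @ post \<turnstile> map Tape (u @ v) @ Finish # post"
  using assms
proof (induction v arbitrary: u rule: list.induct)
  case (Cons a v)
  have "production [Finish, Tape a] [Tape a, Finish]"
    using Cons.prems by (simp add: production.finish_right)
  from simulation_step[OF this, of "map Tape u" "map Tape v @ post"]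
  show ?case
    using Cons.IH[of "u @ [a]"] Cons.prems by (simp add: converse_rtranclp_into_rtranclp)
qed simp

abbreviation initial_config :: "'a list \<Rightarrow> 'a sim_symbol list" where
  "initial_config w \<equiv> [LeftMark, Scan (summary [])] @ map Tape w @ [RightMark]"

lemma simulate_step:
  assumes "sc_step \<gamma> w w'"
  shows "initial_config w \<turnstile> initial_config w'"
proof -
  obtain r where w: "w \<in> lists (alphabet \<gamma>)" and w': "w' \<in> lists (alphabet \<gamma>)"
    and r: "r \<in> sc_rules \<gamma>" "sc_rule_step r w w'"
    using assms by (auto simp: sc_step_def)
  obtain c where c: "left_ctx r = []" "right_ctx r = []" "core r = [c]"
    using size_1_0_0_rule[OF degree size r(1)] by blast
  obtain x y where en: "enabled r w" and
    xy: "kind r = Ins \<and> w = x @ y \<and> w' = x @ c # y \<or> kind r = Del \<and> w = x @ c # y \<and> w' = x @ y"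
    using r(2) sc_rule_step_single[OF c] by blast
  have "initial_config w \<turnstile> LeftMark # map Tape w @ [Scan (summary w), RightMark]"
    using scan_right[of "[]" w] w by simp
  also have "\<dots> \<turnstile> LeftMark # map Tape w @ [Apply r, RightMark]"
    using simulation_step[OF production.select[OF w r(1) en], of "LeftMark # map Tape w" "[]"]
    by simp
  also have "\<dots> \<turnstile> initial_config w'"
    using xy
  proof
    assume ins: "kind r = Ins \<and> w = x @ y \<and> w' = x @ c # y"
    have "LeftMark # map Tape w @ [Apply r, RightMark] \<turnstile>
        (LeftMark # map Tape x) @ Apply r # map Tape y @ [RightMark]"
      using move_left[OF production.apply_left[OF _ r(1)], of y "LeftMark # map Tape x"] ins w
      by simp
    also have "\<dots> \<turnstile> (LeftMark # map Tape x) @ [Tape c, Return] @ map Tape y @ [RightMark]"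
      using simulation_step[OF production.insert[OF r(1) _ c(3)],
          of "LeftMark # map Tape x" "map Tape y @ [RightMark]"] ins by auto
    also have "\<dots> = [LeftMark] @ map Tape (x @ [c]) @ Return # map Tape y @ [RightMark]"
      by simp
    also have "\<dots> \<turnstile> [LeftMark] @ Return # map Tape (x @ [c]) @ map Tape y @ [RightMark]"
      by (rule move_left[OF production.return_left]) (use w' ins in auto)
    also have "\<dots> \<turnstile> initial_config w'"
      using simulation_step[OF production.restart, of "[]" "map Tape w' @ [RightMark]"] ins by auto
    finally show ?thesis .
  next
    assume del: "kind r = Del \<and> w = x @ c # y \<and> w' = x @ y"
    have "LeftMark # map Tape w @ [Apply r, RightMark] \<turnstile>
        (LeftMark # map Tape x) @ Apply r # map Tape (c # y) @ [RightMark]"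
      using move_left[OF production.apply_left[OF _ r(1)], of "c # y" "LeftMark # map Tape x"] del w
      by simp
    also have "\<dots> = (LeftMark # map Tape x) @ [Apply r, Tape c] @ map Tape y @ [RightMark]"
      by simp
    also have "\<dots> \<turnstile> (LeftMark # map Tape x) @ [Return] @ map Tape y @ [RightMark]"
      using simulation_step[OF production.delete[OF r(1) _ c(3)],
          of "LeftMark # map Tape x" "map Tape y @ [RightMark]"] del by auto
    also have "\<dots> = [LeftMark] @ map Tape x @ Return # map Tape y @ [RightMark]"
      by simp
    also have "\<dots> \<turnstile> [LeftMark] @ Return # map Tape x @ map Tape y @ [RightMark]"
      by (rule move_left[OF production.return_left]) (use w' del in auto)
    also have "\<dots> \<turnstile> initial_config w'"
      using simulation_step[OF production.restart, of "[]" "map Tape w' @ [RightMark]"] del by auto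
    finally show ?thesis .
  qed
  finally show ?thesis .
qed

lemma simulate_reachable:
  assumes "reachable w"
  shows "[Start] \<turnstile> map Tape w"
proof -
  obtain x where x: "x \<in> axioms \<gamma>" "(sc_step \<gamma>)\<^sup>*\<^sup>* x w"
    using assms by (auto simp: reachable_def)
  from x(2) have "initial_config x \<turnstile> initial_config w"
    by induction (auto intro: rtranclp_trans dest!: simulate_step)
  moreover have "[Start] \<turnstile> initial_config x"
    using simulation_step[OF production.start[OF x(1)], of "[]" "[]"] by simp
  moreover have "initial_config w \<turnstile> map Tape [] @ Finish # map Tape w @ [RightMark]"
    using simulation_step[OF production.finish, of "[]" "map Tape w @ [RightMark]"] by auto
  moreover have "map Tape [] @ Finish # map Tape w @ [RightMark] \<turnstile>
      map Tape ([] @ w) @ Finish # [RightMark]"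
    using finish_right reachable_lists[OF assms] by blast
  moreover have "map Tape ([] @ w) @ Finish # [RightMark] \<turnstile> map Tape w"
    using simulation_step[OF production.stop, of "map Tape w" "[]"] by simp
  ultimately show ?thesis
    by (meson rtranclp_trans)
qed

text \<open>A terminal word contains no head, which leaves only \<open>result\<close> among the
  configurations; its word is reachable in the system.\<close>

lemma language_simulation: "grammar_language simulation = map Tape ` sc_language \<gamma>"
proof (intro equalityI subsetI)
  fix z assume "z \<in> grammar_language simulation"
  then have z: "z \<in> lists (Tape ` terminals \<gamma>)" "[Start] \<turnstile> z"
    by (auto simp: grammar_language_def simulation_def)
  from z(2) have "config z"
    by induction (auto intro: config.start config_step)
  then obtain w where w: "z = map Tape w" "reachable w"
  proof cases
    case (result w)
    then show thesis using that by blast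
  qed (use z(1) in auto)
  moreover have "w \<in> lists (terminals \<gamma>)"
    using z(1) w(1) by (auto simp: in_lists_conv_set)
  ultimately show "z \<in> map Tape ` sc_language \<gamma>"
    by (auto simp: sc_language_def reachable_def)
next
  fix z assume "z \<in> map Tape ` sc_language \<gamma>"
  then obtain w where w: "z = map Tape w" "w \<in> lists (terminals \<gamma>)" "reachable w"
    by (auto simp: sc_language_def reachable_def)
  then show "z \<in> grammar_language simulation"
    using simulate_reachable[OF w(3)] by (auto simp: grammar_language_def simulation_def)
qed

lemma finite_symbols: "finite (nonterminals simulation \<union> grammar_terminals simulation)"
  using type0_simulation by (simp add: type0_grammar_def)

end

lemma map_rename_image:
  assumes "L \<subseteq> lists V" "\<And>a. a \<in> V \<Longrightarrow> f (e a) = a"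
  shows "map f ` map e ` L = L"
proof -
  have "map f (map e w) = w" if "w \<in> L" for w
    using that assms by (auto intro!: map_idI)
  then show ?thesis
    by (auto simp: image_image)
qed

theorem SC_INS_DEL_subset_RE:
  "(SC_INS_DEL 2 2 (1, 0, 0) (1, 0, 0) :: 'a::infinite list set set) \<subseteq> RE"
proof
  fix L :: "'a list set" assume "L \<in> SC_INS_DEL 2 2 (1, 0, 0) (1, 0, 0)"
  then obtain \<gamma> where L: "L = sc_language \<gamma>" and \<gamma>: "single_symbol_system \<gamma>"
    by (auto simp: SC_INS_DEL_def single_symbol_system_def)
  interpret single_symbol_system \<gamma> by (rule \<gamma>)
  obtain f where f: "inj_on f (nonterminals simulation \<union> grammar_terminals simulation)"
    "\<And>a. a \<in> alphabet \<gamma> \<Longrightarrow> f (Tape a) = a"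
    using renaming_exists[OF finite_symbols finite_alphabet, of Tape] by (auto simp: inj_def)
  have "L \<subseteq> lists (alphabet \<gamma>)"
    using L terminals_subset by (auto simp: sc_language_def)
  then have "grammar_language (rename_grammar f simulation) = L"
    using grammar_language_rename[OF type0_simulation f(1)] map_rename_image[of L _ f Tape] f(2)
    by (simp add: L language_simulation)
  then show "L \<in> RE"
    using type0_grammar_rename[OF type0_simulation f(1)] unfolding RE_def by blast
qed

section \<open>Simulation of grammars by semi-conditional systems\<close>

datatype 'a edit = Erase "'a option" | Write "'a option"

text \<open>\<open>Cell None\<close> is the separator, so the same \<open>Erase\<close> and
  \<open>Write\<close> serve letters and separators.\<close>

datatype 'a tape = Cell "'a option" | LeftEnd | RightEnd | Cursor "'a edit list"

fun is_cursor :: "'a tape \<Rightarrow> bool" where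
  "is_cursor (Cursor _) = True" | "is_cursor _ = False"

fun is_letter :: "'a tape \<Rightarrow> bool" where
  "is_letter (Cell (Some _)) = True" | "is_letter _ = False"

definition before_block :: "'a tape \<Rightarrow> bool" where
  "before_block c \<longleftrightarrow> c = Cell None \<or> c = LeftEnd"

definition after_block :: "'a tape \<Rightarrow> bool" where
  "after_block c \<longleftrightarrow> is_letter c \<or> c = RightEnd"

definition base_pair :: "'a tape \<Rightarrow> 'a tape \<Rightarrow> bool" where
  "base_pair c d \<longleftrightarrow> before_block c \<and> after_block d \<or> is_letter c \<and> d = Cell None"

fun edited_cell :: "'a edit \<Rightarrow> 'a option" where
  "edited_cell (Erase s) = s" | "edited_cell (Write s) = s"

text \<open>\<open>Write None\<close> is exceptional: the letter just written stands to the left of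
  the cursor and still lacks its separator.\<close>

fun left_ok :: "'a edit \<Rightarrow> 'a tape \<Rightarrow> bool" where
  "left_ok (Write None) c = is_letter c" | "left_ok _ c = before_block c"

fun right_ok :: "'a edit \<Rightarrow> 'a tape \<Rightarrow> bool" where
  "right_ok (Erase s) d = (d = Cell s)" | "right_ok (Write _) d = after_block d"

text \<open>Describes the right neighbour of the new cursor. After a letter has been erased, its
  separator is still there.\<close>

fun next_ok :: "'a edit \<Rightarrow> 'a tape \<Rightarrow> bool" where
  "next_ok (Erase (Some _)) d = (d = Cell None)" | "next_ok _ d = after_block d"

definition single_pair :: "'a edit \<Rightarrow> 'a edit list \<Rightarrow> 'a tape \<Rightarrow> 'a tape \<Rightarrow> bool" where
  "single_pair e es c d \<longleftrightarrow> base_pair c d \<or>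
     left_ok e c \<and> d = Cursor (e # es) \<or> c = Cursor (e # es) \<and> right_ok e d"

text \<open>Admits the tape both before and after the edit, that is \<open>q s q'\<close> as well as
  \<open>q q'\<close>. The permitting words tell the two stages apart, so the edit and retire rules
  share their forbidden pairs.\<close>

definition double_pair :: "'a edit \<Rightarrow> 'a edit list \<Rightarrow> 'a tape \<Rightarrow> 'a tape \<Rightarrow> bool" where
  "double_pair e es c d \<longleftrightarrow> base_pair c d \<or> left_ok e c \<and> d = Cursor (e # es) \<or>
     c = Cursor (e # es) \<and> d \<in> {Cursor es, Cell (edited_cell e)} \<or>
     c = Cell (edited_cell e) \<and> d = Cursor es \<or> c = Cursor es \<and> next_ok e d"

text \<open>The contents of the gap between the old and the new cursor before the edit. Erasing and
  writing exchange \<open>gap_before\<close> and \<open>gap_after\<close>, which allows both kinds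
  of edit to be treated at once.\<close>

fun gap_before :: "'a edit \<Rightarrow> 'a tape list" where
  "gap_before (Erase s) = [Cell s]" | "gap_before (Write s) = []"

fun gap_after :: "'a edit \<Rightarrow> 'a tape list" where
  "gap_after (Erase s) = []" | "gap_after (Write s) = [Cell s]"

section \<open>Factors of length two and uniquely occurring symbols\<close>

lemma sublist_pair_Nil [simp]: "\<not> sublist [a, b] []"
  by (simp add: sublist_def)

lemma sublist_pair_Cons:
  "sublist [a, b] (c # w) \<longleftrightarrow> (a = c \<and> w \<noteq> [] \<and> hd w = b) \<or> sublist [a, b] w"
  by (cases w) (auto simp: sublist_Cons_right)

lemma sublist_pair_append:
  "sublist [a, b] (x @ y) \<longleftrightarrow> sublist [a, b] x \<or> sublist [a, b] y \<or>
    (x \<noteq> [] \<and> y \<noteq> [] \<and> last x = a \<and> hd y = b)"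
  by (induction x) (auto simp: sublist_pair_Cons)

lemma sublist_pair_set: "sublist [a, b] w \<Longrightarrow> a \<in> set w \<and> b \<in> set w"
  using set_mono_sublist[of "[a, b]" w] by simp

lemma successively_iff_sublist:
  "successively A w \<longleftrightarrow> (\<forall>c d. sublist [c, d] w \<longrightarrow> A c d)"
  by (induction w) (auto simp: successively_Cons sublist_pair_Cons)

lemma unique_split:
  assumes "count_list w q = 1" "w = a @ q # b" "w = c @ q # d"
  shows "a = c \<and> b = d"
proof -
  have "q \<notin> set a" "q \<notin> set b"
    using assms(1) unfolding assms(2) by (auto simp: count_list_0_iff)
  then show ?thesis
    using assms(2,3) append_Cons_eq_iff[of q a b] by metis
qed

lemma sublist_pair_right_unique:
  assumes "count_list w q = 1" "sublist [q, d] w" "sublist [q, d'] w"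
  shows "d = d'"
proof -
  obtain x y where "w = x @ q # (d # y)"
    using assms(2) by (auto simp: sublist_def)
  moreover obtain x' y' where "w = x' @ q # (d' # y')"
    using assms(3) by (auto simp: sublist_def)
  ultimately show ?thesis
    using unique_split[OF assms(1)] by blast
qed

lemma sublist_pair_left_unique:
  assumes "count_list w q = 1" "sublist [c, q] w" "sublist [c', q] w"
  shows "c = c'"
proof -
  obtain x y where "w = (x @ [c]) @ q # y"
    using assms(2) by (auto simp: sublist_def)
  moreover obtain x' y' where "w = (x' @ [c']) @ q # y'"
    using assms(3) by (auto simp: sublist_def)
  ultimately show ?thesis
    using unique_split[OF assms(1)] by blast
qed

text \<open>In the longer word the only right neighbour of \<open>q\<close> is \<open>s\<close>, so
  the pair \<open>q q'\<close> is absent there. It can arise only where \<open>s\<close> is taken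
  out.\<close>

lemma pair_opened:
  assumes "count_list (x @ s # y) q = 1" "sublist [q, q'] (x @ y)" "sublist [q, s] (x @ s # y)" "s \<noteq> q'"
  obtains a b where "x = a @ [q]" "y = q' # b"
proof -
  have "\<not> sublist [q, q'] (x @ s # y)"
    using assms sublist_pair_right_unique by metis
  then have "x \<noteq> [] \<and> y \<noteq> [] \<and> last x = q \<and> hd y = q'"
    using assms(2) by (auto simp: sublist_pair_append sublist_pair_Cons)
  then show thesis
    using that[of "butlast x" "tl y"] by (metis append_butlast_last_id list.collapse)
qed

lemma successively_starts:
  assumes "successively A w" "l \<in> set w" "\<And>c. \<not> A c l"
  obtains w' where "w = l # w'"
proof -
  obtain x y where w: "w = x @ l # y"
    using assms(2) by (meson split_list)
  then have "x = []"
    using assms(1,3) by (auto simp: successively_append_iff)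
  then show thesis
    using w that by simp
qed

lemma successively_ends:
  assumes "successively A w" "r \<in> set w" "\<And>d. \<not> A r d"
  obtains w' where "w = w' @ [r]"
proof -
  obtain x y where w: "w = x @ r # y"
    using assms(2) by (meson split_list)
  then have "y = []"
    using assms(1,3) by (auto simp: successively_append_iff successively_Cons)
  then show thesis
    using w that by simp
qed

lemmas pair_defs = single_pair_def double_pair_def base_pair_def before_block_def after_block_def

lemma edit_cases:
  obtains "e = Erase None" | a where "e = Erase (Some a)" | "e = Write None" | a where "e = Write (Some a)"
  by (metis edit.exhaust option.exhaust)

lemma is_letter_iff: "is_letter c \<longleftrightarrow> (\<exists>a. c = Cell (Some a))"
  by (cases c rule: is_letter.cases) auto

lemma no_pair_ends [simp]:
  "\<not> single_pair e es c LeftEnd" "\<not> double_pair e es c LeftEnd"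
  "\<not> single_pair e es RightEnd d" "\<not> double_pair e es RightEnd d"
  by (cases e rule: edit_cases; auto simp: pair_defs is_letter_iff)+

text \<open>This is where alternation pays off. On an ordinary tape a letter stands between a
  separator or \<open>LeftEnd\<close> and a separator, and a separator between a letter and a letter
  or \<open>RightEnd\<close>; in neither case may the two outer symbols be adjacent. A cell that can
  come or go therefore touches a cursor.\<close>

lemma cell_between:
  assumes "double_pair e es c (Cell (edited_cell e))" "double_pair e es (Cell (edited_cell e)) d"
    "double_pair e es c d"
  shows "c = Cursor (e # es) \<or> d = Cursor es"
  using assms by (cases e rule: edit_cases) (auto simp: pair_defs is_letter_iff)

lemma no_double_cell: "\<not> double_pair e es (Cell (edited_cell e)) (Cell (edited_cell e))"
  by (cases e rule: edit_cases) (auto simp: pair_defs)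

section \<open>Conditions of the rules and the place of an edit\<close>

abbreviation no_cursor :: "'a tape list \<Rightarrow> bool" where
  "no_cursor w \<equiv> \<forall>c \<in> set w. \<not> is_cursor c"

fun gap_factors :: "'a tape \<Rightarrow> 'a tape \<Rightarrow> 'a tape list \<Rightarrow> 'a tape list set" where
  "gap_factors q q' [] = {[q, q']}" | "gap_factors q q' (c # _) = {[q, c], [c, q']}"

definition announce_ok :: "'a edit \<Rightarrow> 'a edit list \<Rightarrow> 'a tape list \<Rightarrow> bool" where
  "announce_ok e es w \<longleftrightarrow> Cursor (e # es) \<in> set w \<and> LeftEnd \<in> set w \<and> RightEnd \<in> set w \<and>
     (\<forall>c \<in> set w. is_cursor c \<longrightarrow> c = Cursor (e # es)) \<and> successively (single_pair e es) w"

definition gap_ok :: "'a edit \<Rightarrow> 'a edit list \<Rightarrow> 'a tape list \<Rightarrow> 'a tape list \<Rightarrow> bool" where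
  "gap_ok e es m w \<longleftrightarrow>
     (\<forall>x \<in> gap_factors (Cursor (e # es)) (Cursor es) m. sublist x w) \<and>
     LeftEnd \<in> set w \<and> RightEnd \<in> set w \<and> successively (double_pair e es) w"

lemma gap_ok_cursors:
  assumes "gap_ok e es m w"
  shows "Cursor (e # es) \<in> set w \<and> Cursor es \<in> set w"
  using assms by (cases m) (auto simp: gap_ok_def dest: sublist_pair_set)

text \<open>No admissible pair has \<open>LeftEnd\<close> on its right or \<open>RightEnd\<close> on
  its left. Being present, they are the outermost symbols, and everything else has two
  neighbours.\<close>

lemma gap_ok_ends:
  assumes "gap_ok e es m w" "w = x @ s # y" "s \<noteq> LeftEnd" "s \<noteq> RightEnd"
  shows "x \<noteq> [] \<and> y \<noteq> []"
proof -
  have ok: "successively (double_pair e es) w" "LeftEnd \<in> set w" "RightEnd \<in> set w"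
    using assms(1) by (auto simp: gap_ok_def)
  obtain w1 where "w = LeftEnd # w1"
    using successively_starts[OF ok(1,2)] by (metis no_pair_ends(2))
  moreover obtain w2 where "w = w2 @ [RightEnd]"
    using successively_ends[OF ok(1,3)] by (metis no_pair_ends(4))
  ultimately show ?thesis
    using assms(2-) by (cases x; cases y rule: rev_cases) auto
qed

text \<open>A second application of the same cell edit is impossible: wherever the extra cell is,
  its neighbours would have been a forbidden pair without it.\<close>

lemma no_second_edit:
  assumes w1: "gap_ok e es (gap_before e) (x @ Cell (edited_cell e) # y)"
    and w2: "gap_ok e es (gap_before e) (x @ y)"
    and unique: "count_list (x @ y) (Cursor (e # es)) = 1" "count_list (x @ y) (Cursor es) = 1"
  shows False
proof -
  let ?q = "Cursor (e # es)" and ?q' = "Cursor es" and ?s = "Cell (edited_cell e)"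
  have ne: "x \<noteq> []" "y \<noteq> []"
    using gap_ok_ends[OF w1] by auto
  have ok1: "successively (double_pair e es) (x @ ?s # y)"
    and ok2: "successively (double_pair e es) (x @ y)"
    using w1 w2 by (auto simp: gap_ok_def)
  have unique1: "count_list (x @ ?s # y) ?q = 1" "count_list (x @ ?s # y) ?q' = 1"
    using unique by auto
  have pairs: "double_pair e es (last x) ?s" "double_pair e es ?s (hd y)"
    "double_pair e es (last x) (hd y)"
    using ok1 ok2 ne by (auto simp: successively_append_iff successively_Cons)
  from cell_between[OF this] show False
  proof
    assume q: "last x = ?q"
    then have 1: "sublist [?q, ?s] (x @ ?s # y)" and 2: "sublist [?q, hd y] (x @ y)"
      using ne by (auto simp: sublist_pair_append)
    show False
    proof (cases e)
      case (Erase t)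
      then have "sublist [?q, ?s] (x @ y)"
        using w2 by (simp add: gap_ok_def)
      then have "hd y = ?s"
        using sublist_pair_right_unique[OF unique(1)] 2 by blast
      then show False
        using pairs(2) no_double_cell by metis
    next
      case (Write t)
      then have "sublist [?q, ?q'] (x @ ?s # y)"
        using w1 by (simp add: gap_ok_def)
      then show False
        using sublist_pair_right_unique[OF unique1(1) 1] by blast
    qed
  next
    assume q: "hd y = ?q'"
    then have 1: "sublist [?s, ?q'] (x @ ?s # y)" and 2: "sublist [last x, ?q'] (x @ y)"
      using ne by (auto simp: sublist_pair_append sublist_pair_Cons)
    show False
    proof (cases e)
      case (Erase t)
      then have "sublist [?s, ?q'] (x @ y)"
        using w2 by (simp add: gap_ok_def)
      then have "last x = ?s"
        using sublist_pair_left_unique[OF unique(2)] 2 by blast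
      then show False
        using pairs(1) no_double_cell by metis
    next
      case (Write t)
      then have "sublist [?q, ?q'] (x @ ?s # y)"
        using w1 by (simp add: gap_ok_def)
      then show False
        using sublist_pair_left_unique[OF unique1(2) 1] by blast
    qed
  qed
qed

text \<open>The cursor cannot be deleted before the edit has been carried out: the symbol right of
  the new cursor used to follow the old cursor, respectively an already present copy of the cell
  to be written, and is not allowed after the new cursor.\<close>

lemma no_premature_retire:
  assumes ok: "gap_ok e es (gap_after e) (x @ Cursor es # y)"
    and old: "successively (single_pair e es) (x @ y)"
    and unique: "count_list (x @ Cursor es # y) (Cursor es) = 1"
  shows False
proof -
  let ?q = "Cursor (e # es)" and ?q' = "Cursor es" and ?s = "Cell (edited_cell e)"
  have ne: "x \<noteq> []" "y \<noteq> []"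
    using gap_ok_ends[OF ok] by auto
  have "double_pair e es ?q' (hd y)"
    using ok ne by (auto simp: gap_ok_def successively_append_iff successively_Cons)
  then have nxt: "next_ok e (hd y)"
    by (cases e rule: edit_cases) (auto simp: pair_defs)
  have last: "sublist [last x, ?q'] (x @ ?q' # y)"
    using ne by (simp add: sublist_pair_append)
  have old_pair: "single_pair e es (last x) (hd y)"
    using old ne by (auto simp: successively_append_iff)
  show False
  proof (cases e)
    case (Erase t)
    then have "sublist [?q, ?q'] (x @ ?q' # y)"
      using ok by (simp add: gap_ok_def)
    then have "last x = ?q"
      using sublist_pair_left_unique[OF unique last] by blast
    then show False
      using old_pair nxt Erase by (cases e rule: edit_cases) (auto simp: pair_defs)
  next
    case (Write t)
    then have "sublist [?s, ?q'] (x @ ?q' # y)" and qs: "sublist [?q, ?s] (x @ ?q' # y)"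
      using ok by (auto simp: gap_ok_def)
    then have "last x = ?s"
      using sublist_pair_left_unique[OF unique last] by blast
    moreover have "sublist [?q, ?s] (x @ y)"
      using qs ne by (auto simp: sublist_pair_append sublist_pair_Cons)
    then have "single_pair e es ?q ?s"
      using old by (simp add: successively_iff_sublist)
    ultimately show False
      using old_pair nxt Write by (cases e rule: edit_cases) (auto simp: pair_defs)
  qed
qed

text \<open>Whichever of the two words comes first, the longer one contains \<open>q s\<close> and
  the shorter one \<open>q q'\<close>. Hence \<open>pair_opened\<close> places both an erasure and a
  writing between the cursors.\<close>

lemma edit_position:
  assumes "gap_ok e es (gap_before e) (x @ gap_before e @ y)"
    "gap_ok e es (gap_after e) (x @ gap_after e @ y)"
    and unique: "count_list (x @ y) (Cursor (e # es)) = 1"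
  obtains a b where "x = a @ [Cursor (e # es)]" "y = Cursor es # b"
proof -
  let ?q = "Cursor (e # es)" and ?q' = "Cursor es" and ?s = "Cell (edited_cell e)"
  have "sublist [?q, ?s] (x @ ?s # y)" "sublist [?q, ?q'] (x @ y)"
    using assms(1,2) by (cases e; simp add: gap_ok_def)+
  moreover have "count_list (x @ ?s # y) ?q = 1"
    using unique by simp
  ultimately show thesis
    using that pair_opened by (metis tape.distinct(5))
qed

section \<open>Encoded words and the outcome of a program\<close>

fun spaced :: "'a list \<Rightarrow> 'a option list" where
  "spaced [] = []" | "spaced (a # w) = Some a # None # spaced w"

text \<open>Defined on arbitrary tapes and blind to everything except letters, so it keeps its
  meaning when separators or end markers have been erased.\<close>

fun decode :: "'a tape list \<Rightarrow> 'a list" where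
  "decode [] = []" | "decode (Cell (Some a) # w) = a # decode w" | "decode (_ # w) = decode w"

lemma decode_append [simp]: "decode (x @ y) = decode x @ decode y"
  by (induction x rule: decode.induct) auto

lemma decode_spaced [simp]: "decode (map Cell (spaced w)) = w"
  by (induction w) auto

definition program :: "'a list \<times> 'a list \<Rightarrow> 'a edit list" where
  "program = (\<lambda>(l, r). map Erase (spaced l) @ map Write (spaced r))"

text \<open>\<open>outcome P es u v\<close>: if the edits \<open>es\<close> can be carried out with the cursor between
  \<open>u\<close> and \<open>v\<close>, then the resulting tape decodes to a word satisfying \<open>P\<close>.\<close>

fun outcome :: "('a list \<Rightarrow> bool) \<Rightarrow> 'a edit list \<Rightarrow> 'a tape list \<Rightarrow> 'a tape list \<Rightarrow> bool" where
  "outcome P [] u v = P (decode (u @ v))"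
| "outcome P (Erase s # es) u v = (\<forall>v'. v = Cell s # v' \<longrightarrow> outcome P es u v')"
| "outcome P (Write s # es) u v = outcome P es (u @ [Cell s]) v"

lemma outcome_edit:
  assumes "outcome P (e # es) u (gap_before e @ v)"
  shows "outcome P es (u @ gap_after e) v"
  using assms by (cases e) auto

lemma outcome_erase:
  assumes "\<And>v'. v = map Cell t @ v' \<Longrightarrow> outcome P es u v'"
  shows "outcome P (map Erase t @ es) u v"
  using assms by (induction t arbitrary: v) auto

lemma outcome_write: "outcome P (map Write t) u v \<longleftrightarrow> P (decode (u @ map Cell t @ v))"
  by (induction t arbitrary: u) (simp_all del: decode_append)

section \<open>The simulating system\<close>

locale grammar_simulation =
  fixes G :: "'a grammar"
  assumes type0: "type0_grammar G"
begin

definition sentential :: "'a list \<Rightarrow> bool" where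
  "sentential w \<longleftrightarrow> (grammar_step G)\<^sup>*\<^sup>* [start_symbol G] w"

text \<open>The tape may be damaged and the cursor may have been put anywhere. If the encoded
  \<open>l\<close> does not follow the cursor, the outcome holds vacuously; if it does,
  \<open>l\<close> is a factor of the decoded word at that place and the production applies.\<close>

lemma outcome_program:
  assumes "sentential (decode (u @ v))" "p \<in> productions G"
  shows "outcome sentential (program p) u v"
proof -
  obtain l r where p: "p = (l, r)"
    by fastforce
  show ?thesis
    unfolding program_def p prod.case
  proof (rule outcome_erase)
    fix v' assume v: "v = map Cell (spaced l) @ v'"
    have "grammar_step G (decode u @ l @ decode v') (decode u @ r @ decode v')"
      using assms(2) unfolding grammar_step_def p by blast
    then have "sentential (decode u @ r @ decode v')"
      using assms(1) unfolding sentential_def v by simp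
    then show "outcome sentential (map Write (spaced r)) u v'"
      by (simp add: outcome_write)
  qed
qed

text \<open>Closed under suffixes because each edit passes to the tail of its program. Inserting
  \<open>[]\<close> keeps \<open>Cursor []\<close>, the symbol deleted by \<open>stop_rule\<close>,
  in the alphabet even for a grammar without productions.\<close>

definition programs :: "'a edit list set" where
  "programs = insert [] (\<Union>p \<in> productions G. set (suffixes (program p)))"

definition cursors :: "'a tape set" where
  "cursors = Cursor ` programs"

definition tape_alphabet :: "'a tape set" where
  "tape_alphabet = Cell ` insert None (Some ` (nonterminals G \<union> grammar_terminals G)) \<union>
     {LeftEnd, RightEnd} \<union> cursors"

definition excluding :: "('a tape \<Rightarrow> 'a tape \<Rightarrow> bool) \<Rightarrow> 'a tape list set" where
  "excluding A = {[c, d] | c d. c \<in> tape_alphabet \<and> d \<in> tape_alphabet \<and> \<not> A c d}"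

definition singles :: "'a tape set \<Rightarrow> 'a tape list set" where
  "singles C = (\<lambda>c. [c]) ` C"

definition point_rule ::
  "insdel_kind \<Rightarrow> 'a tape \<Rightarrow> 'a tape list set \<Rightarrow> 'a tape list set \<Rightarrow> 'a tape sc_rule" where
  "point_rule k c P Q = \<lparr>kind = k, left_ctx = [], core = [c], right_ctx = [],
     permitting = P, forbidding = Q\<rparr>"

definition clean_rule :: "'a tape \<Rightarrow> 'a tape sc_rule" where
  "clean_rule c = point_rule Del c {} (singles cursors)"

definition start_rule :: "'a list \<times> 'a list \<Rightarrow> 'a tape sc_rule" where
  "start_rule p = point_rule Ins (Cursor (program p)) {} (singles cursors)"

definition stop_rule :: "'a tape sc_rule" where
  "stop_rule = point_rule Del (Cursor []) {} (singles (cursors - {Cursor []}))"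

definition announce_rule :: "'a edit \<Rightarrow> 'a edit list \<Rightarrow> 'a tape sc_rule" where
  "announce_rule e es = point_rule Ins (Cursor es)
     {[Cursor (e # es)], [LeftEnd], [RightEnd]}
     (singles (cursors - {Cursor (e # es)}) \<union> excluding (single_pair e es))"

definition gap_conditions :: "'a edit \<Rightarrow> 'a edit list \<Rightarrow> 'a tape list \<Rightarrow> 'a tape list set" where
  "gap_conditions e es m =
     gap_factors (Cursor (e # es)) (Cursor es) m \<union> {[LeftEnd], [RightEnd]}"

definition edit_rule :: "'a edit \<Rightarrow> 'a edit list \<Rightarrow> 'a tape sc_rule" where
  "edit_rule e es = point_rule (case e of Erase _ \<Rightarrow> Del | Write _ \<Rightarrow> Ins) (Cell (edited_cell e))
     (gap_conditions e es (gap_before e)) (excluding (double_pair e es))"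

definition retire_rule :: "'a edit \<Rightarrow> 'a edit list \<Rightarrow> 'a tape sc_rule" where
  "retire_rule e es = point_rule Del (Cursor (e # es))
     (gap_conditions e es (gap_after e)) (excluding (double_pair e es))"

definition simulation_rules :: "'a tape sc_rule set" where
  "simulation_rules = clean_rule ` {Cell None, LeftEnd, RightEnd} \<union>
     start_rule ` productions G \<union> {stop_rule} \<union>
     (\<Union>(e, es) \<in> {(e, es). e # es \<in> programs}.
        {announce_rule e es, edit_rule e es, retire_rule e es})"

definition simulation :: "'a tape sc_system" where
  "simulation = \<lparr>alphabet = tape_alphabet, terminals = (Cell \<circ> Some) ` grammar_terminals G,
     axioms = {[LeftEnd, Cell (Some (start_symbol G)), Cell None, RightEnd]},
     sc_rules = simulation_rules\<rparr>"

inductive tape_step :: "'a tape list \<Rightarrow> 'a tape list \<Rightarrow> bool" where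
  clean: "c \<in> {Cell None, LeftEnd, RightEnd} \<Longrightarrow> no_cursor w \<Longrightarrow>
    w = x @ c # y \<Longrightarrow> w' = x @ y \<Longrightarrow> tape_step w w'"
| start: "p \<in> productions G \<Longrightarrow> no_cursor w \<Longrightarrow>
    w = x @ y \<Longrightarrow> w' = x @ Cursor (program p) # y \<Longrightarrow> tape_step w w'"
| stop: "\<forall>c \<in> set w. is_cursor c \<longrightarrow> c = Cursor [] \<Longrightarrow>
    w = x @ Cursor [] # y \<Longrightarrow> w' = x @ y \<Longrightarrow> tape_step w w'"
| announce: "e # es \<in> programs \<Longrightarrow> announce_ok e es w \<Longrightarrow>
    w = x @ y \<Longrightarrow> w' = x @ Cursor es # y \<Longrightarrow> tape_step w w'"
| edit: "e # es \<in> programs \<Longrightarrow> gap_ok e es (gap_before e) w \<Longrightarrow>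
    w = x @ gap_before e @ y \<Longrightarrow> w' = x @ gap_after e @ y \<Longrightarrow> tape_step w w'"
| retire: "e # es \<in> programs \<Longrightarrow> gap_ok e es (gap_after e) w \<Longrightarrow>
    w = x @ Cursor (e # es) # y \<Longrightarrow> w' = x @ y \<Longrightarrow> tape_step w w'"

lemma point_rule_step:
  "sc_rule_step (point_rule k c P Q) w w' \<longleftrightarrow>
    (\<forall>p \<in> P. sublist p w) \<and> (\<forall>p \<in> Q. \<not> sublist p w) \<and>
    (\<exists>x y. k = Ins \<and> w = x @ y \<and> w' = x @ c # y \<or> k = Del \<and> w = x @ c # y \<and> w' = x @ y)"
  by (subst sc_rule_step_single[where c = c]) (auto simp: point_rule_def enabled_def)

lemma sublist_single: "sublist [c] w \<longleftrightarrow> c \<in> set w"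
  by (induction w) (auto simp: sublist_Cons_right)

lemma cursor_in_cursors:
  assumes "w \<in> lists tape_alphabet" "c \<in> set w"
  shows "is_cursor c \<longleftrightarrow> c \<in> cursors"
  using assms by (auto simp: tape_alphabet_def cursors_def in_lists_conv_set)

lemma singles_iff:
  assumes "w \<in> lists tape_alphabet"
  shows "(\<forall>p \<in> singles (cursors - C). \<not> sublist p w) \<longleftrightarrow> (\<forall>c \<in> set w. is_cursor c \<longrightarrow> c \<in> C)"
  using cursor_in_cursors[OF assms] by (auto simp: singles_def sublist_single)

text \<open>On words over the finite alphabet only finitely many pairs can be neighbours, so a
  finite set of forbidden words of length two expresses \<open>successively A\<close>.\<close>

lemma excluding_iff:
  assumes "w \<in> lists tape_alphabet"
  shows "(\<forall>p \<in> excluding A. \<not> sublist p w) \<longleftrightarrow> successively A w"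
proof -
  have "c \<in> tape_alphabet \<and> d \<in> tape_alphabet" if "sublist [c, d] w" for c d
    using sublist_pair_set[OF that] assms by auto
  then show ?thesis
    unfolding successively_iff_sublist excluding_def by blast
qed

lemma singles_cursors_iff:
  assumes "w \<in> lists tape_alphabet"
  shows "(\<forall>p \<in> singles cursors. \<not> sublist p w) \<longleftrightarrow> no_cursor w"
  using singles_iff[OF assms, of "{}"] by simp

lemma rule_step_iff_tape_step:
  assumes w: "w \<in> lists tape_alphabet"
  shows "(\<exists>r \<in> simulation_rules. sc_rule_step r w w') \<longleftrightarrow> tape_step w w'"
proof -
  have clean_iff: "sc_rule_step (clean_rule c) w w' \<longleftrightarrow>
      no_cursor w \<and> (\<exists>x y. w = x @ c # y \<and> w' = x @ y)" for c
    unfolding clean_rule_def point_rule_step singles_cursors_iff[OF w] by auto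
  have start_iff: "sc_rule_step (start_rule p) w w' \<longleftrightarrow>
      no_cursor w \<and> (\<exists>x y. w = x @ y \<and> w' = x @ Cursor (program p) # y)" for p
    unfolding start_rule_def point_rule_step singles_cursors_iff[OF w] by auto
  have stop_iff: "sc_rule_step stop_rule w w' \<longleftrightarrow>
      (\<forall>c \<in> set w. is_cursor c \<longrightarrow> c = Cursor []) \<and> (\<exists>x y. w = x @ Cursor [] # y \<and> w' = x @ y)"
    unfolding stop_rule_def point_rule_step singles_iff[OF w] by auto
  have announce_iff: "sc_rule_step (announce_rule e es) w w' \<longleftrightarrow>
      announce_ok e es w \<and> (\<exists>x y. w = x @ y \<and> w' = x @ Cursor es # y)" for e es
    unfolding announce_rule_def point_rule_step ball_Un singles_iff[OF w] excluding_iff[OF w]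
    by (auto simp: announce_ok_def sublist_single)
  have edit_iff: "sc_rule_step (edit_rule e es) w w' \<longleftrightarrow> gap_ok e es (gap_before e) w \<and>
      (\<exists>x y. w = x @ gap_before e @ y \<and> w' = x @ gap_after e @ y)" for e es
    unfolding edit_rule_def point_rule_step gap_conditions_def ball_Un excluding_iff[OF w]
    by (cases e) (auto simp: gap_ok_def sublist_single)
  have retire_iff: "sc_rule_step (retire_rule e es) w w' \<longleftrightarrow> gap_ok e es (gap_after e) w \<and>
      (\<exists>x y. w = x @ Cursor (e # es) # y \<and> w' = x @ y)" for e es
    unfolding retire_rule_def point_rule_step gap_conditions_def ball_Un excluding_iff[OF w]
    by (auto simp: gap_ok_def sublist_single)
  have rules: "clean_rule (Cell None) \<in> simulation_rules" "clean_rule LeftEnd \<in> simulation_rules"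
    "clean_rule RightEnd \<in> simulation_rules" "stop_rule \<in> simulation_rules"
    "p \<in> productions G \<Longrightarrow> start_rule p \<in> simulation_rules"
    "e # es \<in> programs \<Longrightarrow> announce_rule e es \<in> simulation_rules"
    "e # es \<in> programs \<Longrightarrow> edit_rule e es \<in> simulation_rules"
    "e # es \<in> programs \<Longrightarrow> retire_rule e es \<in> simulation_rules" for p e es
    by (auto simp: simulation_rules_def)
  show ?thesis
  proof
    assume "\<exists>r \<in> simulation_rules. sc_rule_step r w w'"
    then obtain r where r: "r \<in> simulation_rules" "sc_rule_step r w w'"
      by blast
    have "r \<in> clean_rule ` {Cell None, LeftEnd, RightEnd} \<or> r \<in> start_rule ` productions G \<or>
        r = stop_rule \<or> (\<exists>e es. e # es \<in> programs \<and>
          (r = announce_rule e es \<or> r = edit_rule e es \<or> r = retire_rule e es))"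
      using r(1) by (simp add: simulation_rules_def) blast
    then show "tape_step w w'"
    proof (elim disjE imageE exE conjE)
      fix c assume c: "r = clean_rule c" "c \<in> {Cell None, LeftEnd, RightEnd}"
      then obtain x y where "no_cursor w" "w = x @ c # y" "w' = x @ y"
        using r(2) clean_iff by auto
      then show ?thesis by (rule tape_step.clean[OF c(2)])
    next
      fix p assume p: "r = start_rule p" "p \<in> productions G"
      then obtain x y where "no_cursor w" "w = x @ y" "w' = x @ Cursor (program p) # y"
        using r(2) start_iff by auto
      then show ?thesis by (rule tape_step.start[OF p(2)])
    next
      assume "r = stop_rule"
      then show ?thesis
        using r(2) stop_iff by (auto intro: tape_step.stop)
    next
      fix e es assume e: "e # es \<in> programs" "r = announce_rule e es"
      then obtain x y where "announce_ok e es w" "w = x @ y" "w' = x @ Cursor es # y"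
        using r(2) announce_iff by auto
      then show ?thesis by (rule tape_step.announce[OF e(1)])
    next
      fix e es assume e: "e # es \<in> programs" "r = edit_rule e es"
      then obtain x y where "gap_ok e es (gap_before e) w" "w = x @ gap_before e @ y"
        "w' = x @ gap_after e @ y"
        using r(2) edit_iff by auto
      then show ?thesis by (rule tape_step.edit[OF e(1)])
    next
      fix e es assume e: "e # es \<in> programs" "r = retire_rule e es"
      then obtain x y where "gap_ok e es (gap_after e) w" "w = x @ Cursor (e # es) # y"
        "w' = x @ y"
        using r(2) retire_iff by auto
      then show ?thesis by (rule tape_step.retire[OF e(1)])
    qed
  next
    assume "tape_step w w'"
    then show "\<exists>r \<in> simulation_rules. sc_rule_step r w w'"
    proof cases
      case (clean c x y)
      then have "sc_rule_step (clean_rule c) w w'"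
        unfolding clean_iff by blast
      then show ?thesis using clean rules by blast
    next
      case (start p x y)
      then have "sc_rule_step (start_rule p) w w'"
        unfolding start_iff by blast
      then show ?thesis using start rules by blast
    next
      case stop
      then have "sc_rule_step stop_rule w w'"
        unfolding stop_iff by blast
      then show ?thesis using rules by blast
    next
      case (announce e es x y)
      then have "sc_rule_step (announce_rule e es) w w'"
        unfolding announce_iff by blast
      then show ?thesis using announce rules by blast
    next
      case (edit e es x y)
      then have "sc_rule_step (edit_rule e es) w w'"
        unfolding edit_iff by blast
      then show ?thesis using edit rules by blast
    next
      case (retire e es x y)
      then have "sc_rule_step (retire_rule e es) w w'"
        unfolding retire_iff by blast
      then show ?thesis using retire rules by blast
    qed
  qed
qed

lemma sc_step_iff:
  "sc_step simulation w w' \<longleftrightarrow>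
    w \<in> lists tape_alphabet \<and> w' \<in> lists tape_alphabet \<and> tape_step w w'"
  using rule_step_iff_tape_step by (auto simp: sc_step_def simulation_def)

subsection \<open>Soundness\<close>

text \<open>In \<open>announced\<close> the place of the new cursor is left open, since nothing has
  tested it yet; the pair condition of the preceding word is kept to refute a premature retirement.
  \<open>stuck\<close> demands the failure of both gap conditions, and with two cursors no other
  rule could fire.\<close>

inductive sound :: "'a tape list \<Rightarrow> bool" where
  idle: "no_cursor w \<Longrightarrow> sentential (decode w) \<Longrightarrow> sound w"
| editing: "no_cursor (u @ v) \<Longrightarrow> outcome sentential es u v \<Longrightarrow>
    w = u @ Cursor es # v \<Longrightarrow> sound w"
| announced: "no_cursor (u @ v) \<Longrightarrow> outcome sentential (e # es) u v \<Longrightarrow>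
    successively (single_pair e es) (u @ Cursor (e # es) # v) \<Longrightarrow>
    x @ y = u @ Cursor (e # es) # v \<Longrightarrow> w = x @ Cursor es # y \<Longrightarrow> sound w"
| edited: "no_cursor (u @ v) \<Longrightarrow> outcome sentential es (u @ gap_after e) v \<Longrightarrow>
    w = u @ Cursor (e # es) # gap_after e @ Cursor es # v \<Longrightarrow> sound w"
| stuck: "Cursor (e # es) \<in> set w \<Longrightarrow> Cursor es \<in> set w \<Longrightarrow>
    \<forall>c \<in> set w. is_cursor c \<longrightarrow> c \<in> {Cursor (e # es), Cursor es} \<Longrightarrow>
    \<not> gap_ok e es (gap_before e) w \<Longrightarrow> \<not> gap_ok e es (gap_after e) w \<Longrightarrow> sound w"

text \<open>Every rule without a gap condition forbids at least one of the two cursors. A gap rule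
  needs two cursors whose lists differ in length by one, in a fixed order, so comparing lengths
  leaves only the rules of the present pair.\<close>

lemma two_cursor_step:
  assumes "tape_step w w'" "Cursor (e # es) \<in> set w" "Cursor es \<in> set w"
    "\<forall>c \<in> set w. is_cursor c \<longrightarrow> c \<in> {Cursor (e # es), Cursor es}"
  obtains x y where "gap_ok e es (gap_before e) w" "w = x @ gap_before e @ y" "w' = x @ gap_after e @ y"
  | x y where "gap_ok e es (gap_after e) w" "w = x @ Cursor (e # es) # y" "w' = x @ y"
proof -
  have same: "e1 = e \<and> es1 = es" if "gap_ok e1 es1 m w" for e1 es1 m
  proof -
    have "Cursor (e1 # es1) \<in> {Cursor (e # es), Cursor es}" "Cursor es1 \<in> {Cursor (e # es), Cursor es}"
      using gap_ok_cursors[OF that] assms(4) by auto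
    then show ?thesis
      by (auto dest: arg_cong[of _ _ length])
  qed
  from assms(1) show thesis
  proof cases
    case (clean c x y)
    then show thesis using assms(2) by fastforce
  next
    case (start p x y)
    then show thesis using assms(2) by fastforce
  next
    case stop
    then show thesis using assms(2) by fastforce
  next
    case (announce e1 es1 x y)
    then have "Cursor (e # es) = Cursor (e1 # es1)" "Cursor es = Cursor (e1 # es1)"
      using assms(2,3) unfolding announce_ok_def by (metis is_cursor.simps(1))+
    then show thesis by simp
  next
    case (edit e1 es1 x y)
    then show thesis using same that(1) by blast
  next
    case (retire e1 es1 x y)
    then show thesis using same that(2) by blast
  qed
qed

lemma count_cursor: "no_cursor w \<Longrightarrow> count_list w (Cursor es) = 0"
  by (auto simp: count_list_0_iff)

lemma sound_step_idle:
  assumes "tape_step w w'" "no_cursor w" "sentential (decode w)"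
  shows "sound w'"
  using assms(1)
proof cases
  case (clean c x y)
  then show ?thesis
    using assms(2,3) by (intro sound.idle) auto
next
  case (start p x y)
  then show ?thesis
    using assms(2,3) outcome_program[of x y p] by (intro sound.editing[of x y]) auto
next
  case stop
  then show ?thesis using assms(2) by auto
next
  case (announce e es x y)
  then show ?thesis using assms(2) unfolding announce_ok_def by fastforce
next
  case (edit e es x y)
  then show ?thesis using assms(2) gap_ok_cursors by fastforce
next
  case (retire e es x y)
  then show ?thesis using assms(2) gap_ok_cursors by fastforce
qed

lemma sound_step_editing:
  assumes step: "tape_step w w'" and u: "no_cursor (u @ v)" and out: "outcome sentential es u v"
    and w: "w = u @ Cursor es # v"
  shows "sound w'"
proof -
  have "count_list u (Cursor es) = 0" "count_list v (Cursor es) = 0"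
    using u by (auto intro!: count_cursor)
  then have unique: "count_list w (Cursor es) = 1"
    using w by simp
  have in_w: "Cursor es \<in> set w"
    using w by simp
  have only: "c = Cursor es" if "c \<in> set w" "is_cursor c" for c
    using that u w by auto
  \<comment> \<open>A gap condition asks for cursors named \<open>e1 # es1\<close> and
    \<open>es1\<close>, and these cannot both be \<open>es\<close>.\<close>
  have no_gap: "\<not> gap_ok e1 es1 m w" for e1 es1 m
    using gap_ok_cursors[of e1 es1 m w] only[of "Cursor (e1 # es1)"] only[of "Cursor es1"] by auto
  show ?thesis
    using step
  proof cases
    case clean
    then show ?thesis using in_w by fastforce
  next
    case start
    then show ?thesis using in_w by fastforce
  next
    case (stop x y)
    then have "es = []"
      using in_w by fastforce
    then have "x = u" "y = v"
      using unique_split[OF unique] stop w by blast+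
    then show ?thesis
      using \<open>es = []\<close> stop u out by (intro sound.idle) auto
  next
    case (announce e1 es1 x y)
    then have "es = e1 # es1"
      using only[of "Cursor (e1 # es1)"] by (auto simp: announce_ok_def)
    then show ?thesis
      using announce u out w by (intro sound.announced[of u v e1 es1 x y]) (auto simp: announce_ok_def)
  qed (use no_gap in auto)
qed

text \<open>Here wrong guesses are caught. After an edit, the condition of a repeated edit fails.
  Either the condition for retiring holds, and then both the new cursor and the edit were placed
  correctly, or the tape is stuck. Retiring at once is impossible.\<close>

lemma sound_step_announced:
  assumes step: "tape_step w w'" and u: "no_cursor (u @ v)"
    and out: "outcome sentential (e # es) u v"
    and old: "successively (single_pair e es) (u @ Cursor (e # es) # v)"
    and xy: "x @ y = u @ Cursor (e # es) # v" and w: "w = x @ Cursor es # y"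
  shows "sound w'"
proof -
  let ?q = "Cursor (e # es)" and ?q' = "Cursor es"
  have "set (x @ y) = set (u @ ?q # v)"
    using xy by simp
  then have setw: "set w = insert ?q (insert ?q' (set u \<union> set v))"
    using w by auto
  have "count_list (x @ y) ?q = 1" "count_list (x @ y) ?q' = 0"
    using u unfolding xy by (auto simp: count_cursor)
  then have unique: "count_list w ?q = 1" "count_list w ?q' = 1"
    using w by auto
  have cursors: "?q \<in> set w" "?q' \<in> set w" "\<forall>c \<in> set w. is_cursor c \<longrightarrow> c \<in> {?q, ?q'}"
    using setw u by auto
  from step cursors show ?thesis
  proof (cases rule: two_cursor_step)
    case (1 a b)
    have sets: "set w - {Cell (edited_cell e)} \<subseteq> set w'" "set w' \<subseteq> insert (Cell (edited_cell e)) (set w)"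
      using 1 by (cases e; auto)+
    then have cursors': "?q \<in> set w'" "?q' \<in> set w'" "\<forall>c \<in> set w'. is_cursor c \<longrightarrow> c \<in> {?q, ?q'}"
      using cursors by auto
    have unique_ab: "count_list (a @ b) ?q = 1" "count_list (a @ b) ?q' = 1"
      using unique 1 by (cases e; simp)+
    have "\<not> gap_ok e es (gap_before e) w'"
    proof
      assume *: "gap_ok e es (gap_before e) w'"
      show False
        by (cases e) (use no_second_edit[of e es a b] 1 * unique_ab in simp_all)
    qed
    moreover have "sound w'" if after: "gap_ok e es (gap_after e) w'"
    proof -
      obtain a' b' where ab: "a = a' @ [?q]" "b = ?q' # b'"
        using edit_position[of e es a b] 1 after unique_ab by blast
      then have w_eq: "w = (a' @ ?q # gap_before e) @ ?q' # b'"
        using 1 by simp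
      \<comment> \<open>The new cursor occurs once, so taking it out recovers the tape before the
        announcement; comparing this tape at the old cursor then identifies \<open>u\<close> and
        \<open>v\<close>.\<close>
      from unique_split[OF unique(2) w this]
      have "a' @ ?q # gap_before e @ b' = u @ ?q # v"
        using xy by simp
      moreover have "count_list (u @ ?q # v) ?q = 1"
        using u by (simp add: count_cursor)
      ultimately have "u = a'" "v = gap_before e @ b'"
        using unique_split by metis+
      then show ?thesis
        using u out outcome_edit[of sentential e es a' b'] 1 ab
        by (intro sound.edited[of a' b' es e]) auto
    qed
    ultimately show ?thesis
      using cursors' sound.stuck by blast
  next
    case (2 a b)
    then show ?thesis
      using no_premature_retire[of e es x y] old w xy unique by auto
  qed
qed

lemma sound_step_edited:
  assumes step: "tape_step w w'" and u: "no_cursor (u @ v)"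
    and out: "outcome sentential es (u @ gap_after e) v"
    and w: "w = u @ Cursor (e # es) # gap_after e @ Cursor es # v"
  shows "sound w'"
proof -
  let ?q = "Cursor (e # es)" and ?q' = "Cursor es"
  have "count_list (gap_after e) ?q = 0" "no_cursor (gap_after e)"
    by (cases e; simp)+
  then have unique: "count_list w ?q = 1"
    and cursors: "\<forall>c \<in> set w. is_cursor c \<longrightarrow> c \<in> {?q, ?q'}"
    using w u by (auto simp: count_cursor)
  have "?q \<in> set w" "?q' \<in> set w"
    using w by auto
  from step this cursors show ?thesis
  proof (cases rule: two_cursor_step)
    case (1 x y)
    \<comment> \<open>The old cursor has a single right neighbour, and another application of the
      edit rule would require a different one.\<close>
    have "sublist [?q, if gap_after e = [] then ?q' else Cell (edited_cell e)] w"
      unfolding w by (cases e) (auto simp: sublist_pair_append sublist_pair_Cons)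
    moreover have "sublist [?q, if gap_after e = [] then Cell (edited_cell e) else ?q'] w"
      using 1(1) by (cases e) (auto simp: gap_ok_def)
    ultimately have False
      using sublist_pair_right_unique[OF unique] by (metis tape.distinct(5))
    then show ?thesis ..
  next
    case (2 x y)
    have "x = u \<and> y = gap_after e @ ?q' # v"
      using unique_split[OF unique] 2 w by blast
    then show ?thesis
      using 2 u out \<open>no_cursor (gap_after e)\<close>
      by (intro sound.editing[of "u @ gap_after e" v es]) auto
  qed
qed

lemma sound_step:
  assumes "sound w" "tape_step w w'"
  shows "sound w'"
  using assms(1)
proof cases
  case idle
  then show ?thesis using sound_step_idle assms(2) by blast
next
  case (editing u v es)
  then show ?thesis using sound_step_editing assms(2) by blast
next
  case (announced u v e es x y)
  then show ?thesis using sound_step_announced assms(2) by blast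
next
  case (edited u v es e)
  then show ?thesis using sound_step_edited assms(2) by blast
next
  case (stuck e es)
  from assms(2) stuck(1-3) show ?thesis
    by (cases rule: two_cursor_step) (use stuck in auto)
qed

lemma sound_sentential:
  assumes "sound w" "no_cursor w"
  shows "sentential (decode w)"
  using assms by cases auto

subsection \<open>Completeness\<close>

lemma spaced_subset: "set (spaced w) \<subseteq> insert None (Some ` set w)"
  by (induction w) auto

lemma programs_suffix: "e # es \<in> programs \<Longrightarrow> es \<in> programs"
  by (auto simp: programs_def dest: suffix_ConsD)

lemma program_in_programs: "p \<in> productions G \<Longrightarrow> program p \<in> programs"
  by (auto simp: programs_def)

lemma Cursor_alphabet: "es \<in> programs \<Longrightarrow> Cursor es \<in> tape_alphabet"
  by (simp add: tape_alphabet_def cursors_def)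

lemma word_alphabet:
  assumes "w \<in> lists (nonterminals G \<union> grammar_terminals G)"
  shows "map Cell (spaced w) \<in> lists tape_alphabet"
  using assms spaced_subset[of w] by (fastforce simp: tape_alphabet_def in_lists_conv_set)

lemma production_words:
  assumes "(l, r) \<in> productions G"
  shows "l \<in> lists (nonterminals G \<union> grammar_terminals G)"
    "r \<in> lists (nonterminals G \<union> grammar_terminals G)"
  using assms type0 by (auto simp: type0_grammar_def)

lemma edited_cell_alphabet:
  assumes "e # es \<in> programs"
  shows "Cell (edited_cell e) \<in> tape_alphabet"
proof -
  obtain l r where lr: "(l, r) \<in> productions G" "suffix (e # es) (program (l, r))"
    using assms by (auto simp: programs_def)
  then have "e \<in> set (program (l, r))"
    using set_mono_suffix by fastforce
  then have "Cell (edited_cell e) \<in> set (map Cell (spaced l)) \<union> set (map Cell (spaced r))"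
    by (auto simp: program_def)
  then show ?thesis
    using word_alphabet production_words[OF lr(1)] by (auto simp: in_lists_conv_set)
qed

lemma finite_tape_alphabet: "finite tape_alphabet"
  using type0 by (simp add: tape_alphabet_def cursors_def programs_def type0_grammar_def)

abbreviation short_words :: "'a tape list set" where
  "short_words \<equiv> {x. x \<in> lists tape_alphabet \<and> x \<noteq> [] \<and> length x \<le> 2}"

lemma valid_point_rule:
  assumes "c \<in> tape_alphabet" "finite P" "finite Q" "P \<subseteq> short_words" "Q \<subseteq> short_words"
  shows "valid_sc_rule 2 2 tape_alphabet (point_rule k c P Q)"
  using assms by (auto simp: valid_sc_rule_def point_rule_def)

lemma cursors_subset: "cursors \<subseteq> tape_alphabet"
  by (auto simp: tape_alphabet_def)

lemma finite_excluding: "finite (excluding A)"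
proof (rule finite_subset)
  show "excluding A \<subseteq> (\<lambda>(c, d). [c, d]) ` (tape_alphabet \<times> tape_alphabet)"
    by (auto simp: excluding_def)
qed (simp add: finite_tape_alphabet)

lemma valid_simulation_rules:
  assumes "r \<in> simulation_rules"
  shows "valid_sc_rule 2 2 tape_alphabet r"
proof -
  have singles: "finite (singles (cursors - C))" "singles (cursors - C) \<subseteq> short_words" for C
    using cursors_subset finite_subset[OF cursors_subset finite_tape_alphabet]
    by (auto simp: singles_def)
  note all_singles = singles[of "{}", unfolded Diff_empty]
  have excluding: "excluding A \<subseteq> short_words" for A
    by (auto simp: excluding_def)
  have ends: "LeftEnd \<in> tape_alphabet" "RightEnd \<in> tape_alphabet" "Cell None \<in> tape_alphabet"
    by (auto simp: tape_alphabet_def)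
  have gap: "finite (gap_conditions e es m)" "gap_conditions e es m \<subseteq> short_words"
    if "e # es \<in> programs" "set m \<subseteq> tape_alphabet" for e es m
    using that ends Cursor_alphabet[OF that(1)] Cursor_alphabet[OF programs_suffix[OF that(1)]]
    by (cases m; auto simp: gap_conditions_def)+
  consider c where "c \<in> {Cell None, LeftEnd, RightEnd}" "r = clean_rule c"
    | p where "p \<in> productions G" "r = start_rule p" | "r = stop_rule"
    | e es where "e # es \<in> programs" "r = announce_rule e es"
    | e es where "e # es \<in> programs" "r = edit_rule e es"
    | e es where "e # es \<in> programs" "r = retire_rule e es"
    using assms unfolding simulation_rules_def by fastforce
  then show ?thesis
  proof cases
    case (1 c)
    then have "c \<in> tape_alphabet"
      using ends by auto
    then show ?thesis
      unfolding 1 clean_rule_def by (intro valid_point_rule all_singles) simp_all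
  next
    case (2 p)
    then show ?thesis
      unfolding 2 start_rule_def
      by (intro valid_point_rule all_singles Cursor_alphabet program_in_programs) simp_all
  next
    case 3
    have "Cursor [] \<in> tape_alphabet"
      by (rule Cursor_alphabet) (simp add: programs_def)
    then show ?thesis
      unfolding 3 stop_rule_def by (intro valid_point_rule singles) simp_all
  next
    case (4 e es)
    have "Cursor (e # es) \<in> tape_alphabet" "Cursor es \<in> tape_alphabet"
      using 4 Cursor_alphabet programs_suffix by blast+
    then show ?thesis
      unfolding 4 announce_rule_def using ends
      by (intro valid_point_rule finite_UnI Un_least singles finite_excluding excluding) simp_all
  next
    case (5 e es)
    have "set (gap_before e) \<subseteq> tape_alphabet"
      using edited_cell_alphabet[OF 5(1)] by (cases e) auto
    then show ?thesis
      unfolding 5 edit_rule_def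
      by (intro valid_point_rule gap[OF 5(1)] finite_excluding excluding
          edited_cell_alphabet[OF 5(1)])
  next
    case (6 e es)
    have "set (gap_after e) \<subseteq> tape_alphabet"
      using edited_cell_alphabet[OF 6(1)] by (cases e) auto
    then show ?thesis
      unfolding 6 retire_rule_def
      by (intro valid_point_rule gap[OF 6(1)] finite_excluding excluding Cursor_alphabet[OF 6(1)])
  qed
qed

lemma finite_simulation_rules: "finite simulation_rules"
proof -
  have "finite programs"
    using type0 by (simp add: programs_def type0_grammar_def)
  moreover have "{(e, es). e # es \<in> programs} \<subseteq> (\<lambda>es. (hd es, tl es)) ` programs"
    by force
  ultimately have "finite {(e, es). e # es \<in> programs}"
    by (meson finite_imageI finite_subset)
  then show ?thesis
    using type0 by (auto simp: simulation_rules_def type0_grammar_def)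
qed

lemma degree_simulation: "sc_system_of_degree 2 2 simulation"
  using finite_tape_alphabet finite_simulation_rules valid_simulation_rules type0
  by (auto simp: sc_system_of_degree_def simulation_def tape_alphabet_def type0_grammar_def)

lemma size_simulation: "has_rules_of_size (1, 0, 0) (1, 0, 0) simulation"
  by (auto simp: has_rules_of_size_def simulation_def simulation_rules_def clean_rule_def
      start_rule_def stop_rule_def announce_rule_def edit_rule_def retire_rule_def point_rule_def
      rule_size_le_def)

abbreviation derives (infix "\<turnstile>" 50) where
  "x \<turnstile> y \<equiv> (sc_step simulation)\<^sup>*\<^sup>* x y"

definition left_part :: "'a tape list \<Rightarrow> bool" where
  "left_part u \<longleftrightarrow> u \<in> lists tape_alphabet \<and> no_cursor u \<and> LeftEnd \<in> set u \<and>
     successively base_pair u"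

definition right_part :: "'a tape list \<Rightarrow> bool" where
  "right_part v \<longleftrightarrow> v \<in> lists tape_alphabet \<and> no_cursor v \<and> RightEnd \<in> set v \<and>
     successively base_pair v"

text \<open>Three steps: announce, edit, retire. Since \<open>next_ok\<close> concerns the tape
  beyond the edited cell, it also makes the pairs admissible while a cell to be erased is still
  present.\<close>

lemma simulate_edit:
  assumes e: "e # es \<in> programs" and u: "left_part u" "left_ok e (last u)"
    and v: "right_part v" "next_ok e (hd v)"
  shows "u @ Cursor (e # es) # gap_before e @ v \<turnstile> u @ gap_after e @ Cursor es # v"
proof -
  let ?q = "Cursor (e # es)" and ?q' = "Cursor es"
  have ne: "u \<noteq> []" "v \<noteq> []"
    using u v by (auto simp: left_part_def right_part_def)
  have alph: "?q \<in> tape_alphabet" "?q' \<in> tape_alphabet" "Cell (edited_cell e) \<in> tape_alphabet"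
    using e programs_suffix Cursor_alphabet edited_cell_alphabet by blast+
  have lists: "u \<in> lists tape_alphabet" "v \<in> lists tape_alphabet"
    "gap_before e \<in> lists tape_alphabet" "gap_after e \<in> lists tape_alphabet"
    using u v alph by (cases e; simp add: left_part_def right_part_def)+
  have single: "successively (single_pair e es) u" "successively (single_pair e es) v"
    and double: "successively (double_pair e es) u" "successively (double_pair e es) v"
    using u v by (auto simp: left_part_def right_part_def single_pair_def double_pair_def
        elim!: successively_mono)
  have ok: "announce_ok e es (u @ ?q # gap_before e @ v)"
    using u v ne single unfolding announce_ok_def left_part_def right_part_def
    by (cases e rule: edit_cases)
      (auto simp: successively_append_iff successively_Cons pair_defs is_letter_iff)
  have before: "gap_ok e es (gap_before e) (u @ ?q # gap_before e @ ?q' # v)"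
    using u v ne double unfolding gap_ok_def left_part_def right_part_def
    by (cases e rule: edit_cases)
      (auto simp: successively_append_iff successively_Cons sublist_pair_append sublist_pair_Cons
        pair_defs is_letter_iff)
  have after: "gap_ok e es (gap_after e) (u @ ?q # gap_after e @ ?q' # v)"
    using u v ne double unfolding gap_ok_def left_part_def right_part_def
    by (cases e rule: edit_cases)
      (auto simp: successively_append_iff successively_Cons sublist_pair_append sublist_pair_Cons
        pair_defs is_letter_iff)
  have "tape_step (u @ ?q # gap_before e @ v) (u @ ?q # gap_before e @ ?q' # v)"
    using tape_step.announce[OF e ok, of "u @ ?q # gap_before e" v] by simp
  moreover have "tape_step (u @ ?q # gap_before e @ ?q' # v) (u @ ?q # gap_after e @ ?q' # v)"
    using tape_step.edit[OF e before, of "u @ [?q]" "?q' # v"] by simp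
  moreover have "tape_step (u @ ?q # gap_after e @ ?q' # v) (u @ gap_after e @ ?q' # v)"
    using tape_step.retire[OF e after, of u "gap_after e @ ?q' # v"] by simp
  ultimately have "sc_step simulation (u @ ?q # gap_before e @ v) (u @ ?q # gap_before e @ ?q' # v)"
    "sc_step simulation (u @ ?q # gap_before e @ ?q' # v) (u @ ?q # gap_after e @ ?q' # v)"
    "sc_step simulation (u @ ?q # gap_after e @ ?q' # v) (u @ gap_after e @ ?q' # v)"
    using lists alph unfolding sc_step_iff by simp_all
  then show ?thesis
    by (meson converse_rtranclp_into_rtranclp rtranclp.rtrancl_refl)
qed

lemma right_part_word:
  assumes "l \<in> lists (nonterminals G \<union> grammar_terminals G)" "right_part v" "after_block (hd v)"
  shows "right_part (map Cell (spaced l) @ v) \<and> after_block (hd (map Cell (spaced l) @ v))"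
  using assms(1)
proof (induction l rule: list.induct)
  case (Cons a l)
  let ?v = "map Cell (spaced l) @ v"
  have v: "right_part ?v" "after_block (hd ?v)"
    using Cons by auto
  have "Cell (Some a) \<in> tape_alphabet" "Cell None \<in> tape_alphabet"
    using Cons.prems by (auto simp: tape_alphabet_def)
  then show ?case
    using v by (auto simp: right_part_def successively_Cons pair_defs)
qed (use assms in simp)

lemma left_part_snoc:
  assumes "left_part u" "Cell s \<in> tape_alphabet" "base_pair (last u) (Cell s)"
  shows "left_part (u @ [Cell s])"
  using assms by (auto simp: left_part_def successively_append_iff)

text \<open>Each letter goes together with its separator, at the cost of two edits, so the
  neighbours of the cursor satisfy \<open>before_block\<close> and \<open>after_block\<close> again
  after every round.\<close>

lemma simulate_erase:
  assumes "map Erase (spaced l) @ es \<in> programs" "l \<in> lists (nonterminals G \<union> grammar_terminals G)"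
    "left_part u" "before_block (last u)" "right_part v" "after_block (hd v)"
  shows "u @ Cursor (map Erase (spaced l) @ es) # map Cell (spaced l) @ v \<turnstile> u @ Cursor es # v"
  using assms(1,2)
proof (induction l rule: list.induct)
  case (Cons a l)
  let ?es = "map Erase (spaced l) @ es" and ?v = "map Cell (spaced l) @ v"
  have v: "right_part ?v" "after_block (hd ?v)"
    using right_part_word[OF _ assms(5,6)] Cons.prems by auto
  have es: "Erase (Some a) # Erase None # ?es \<in> programs"
    using Cons.prems by simp
  note es' = programs_suffix[OF es]
  have "right_part (Cell None # ?v)"
    using v edited_cell_alphabet[OF es'] by (auto simp: right_part_def successively_Cons pair_defs)
  then have "u @ Cursor (Erase (Some a) # Erase None # ?es) # Cell (Some a) # Cell None # ?v \<turnstile>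
      u @ Cursor (Erase None # ?es) # Cell None # ?v"
    using simulate_edit[OF es assms(3), of "Cell None # ?v"] assms(4) by simp
  also have "\<dots> \<turnstile> u @ Cursor ?es # ?v"
    using simulate_edit[OF es' assms(3), of ?v] assms(4) v by simp
  also have "\<dots> \<turnstile> u @ Cursor es # v"
    using Cons programs_suffix[OF es'] by simp
  finally show ?case by simp
qed simp

lemma simulate_write:
  assumes "map Write (spaced r) \<in> programs" "r \<in> lists (nonterminals G \<union> grammar_terminals G)"
    "left_part u" "before_block (last u)" "right_part v" "after_block (hd v)"
  shows "u @ Cursor (map Write (spaced r)) # v \<turnstile> u @ map Cell (spaced r) @ Cursor [] # v"
  using assms(1-4)
proof (induction r arbitrary: u rule: list.induct)
  case (Cons a r)
  let ?es = "map Write (spaced r)" and ?u = "u @ [Cell (Some a)]"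
  have es: "Write (Some a) # Write None # ?es \<in> programs"
    using Cons.prems by simp
  note es' = programs_suffix[OF es]
  have u: "left_part ?u" "left_part (?u @ [Cell None])"
    using Cons.prems edited_cell_alphabet[OF es] edited_cell_alphabet[OF es']
    by (auto intro!: left_part_snoc simp: pair_defs simp del: append_assoc)
  have "u @ Cursor (Write (Some a) # Write None # ?es) # v \<turnstile> ?u @ Cursor (Write None # ?es) # v"
    using simulate_edit[OF es Cons.prems(3) _ assms(5)] Cons.prems(4) assms(6) by simp
  also have "\<dots> \<turnstile> (?u @ [Cell None]) @ Cursor ?es # v"
    using simulate_edit[OF es' u(1) _ assms(5)] assms(6) by simp
  also have "\<dots> \<turnstile> (?u @ [Cell None]) @ map Cell (spaced r) @ Cursor [] # v"
    using Cons programs_suffix[OF es'] u(2) by (intro Cons.IH) (auto simp: before_block_def)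
  finally show ?case by simp
qed simp

abbreviation tape_of :: "'a list \<Rightarrow> 'a tape list" where
  "tape_of w \<equiv> LeftEnd # map Cell (spaced w) @ [RightEnd]"

lemma spaced_append: "spaced (x @ y) = spaced x @ spaced y"
  by (induction x rule: spaced.induct) auto

lemma left_part_word:
  assumes "w \<in> lists (nonterminals G \<union> grammar_terminals G)"
  shows "left_part (LeftEnd # map Cell (spaced w)) \<and>
    before_block (last (LeftEnd # map Cell (spaced w)))"
  using assms
proof (induction w rule: rev_induct)
  case Nil
  then show ?case by (simp add: left_part_def before_block_def tape_alphabet_def)
next
  case (snoc a w)
  let ?u = "LeftEnd # map Cell (spaced w)"
  have "Cell (Some a) \<in> tape_alphabet" "Cell None \<in> tape_alphabet"
    using snoc.prems by (auto simp: tape_alphabet_def)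
  then have "left_part ((?u @ [Cell (Some a)]) @ [Cell None])"
    using snoc by (intro left_part_snoc) (auto simp: pair_defs)
  then show ?case
    by (simp add: spaced_append before_block_def)
qed

lemma simulate_grammar_step:
  assumes "x \<in> lists (nonterminals G \<union> grammar_terminals G)" "grammar_step G x y"
  shows "tape_of x \<turnstile> tape_of y"
proof -
  obtain x1 x2 l r where lr: "(l, r) \<in> productions G" and xy: "x = x1 @ l @ x2" "y = x1 @ r @ x2"
    using assms(2) by (auto simp: grammar_step_def)
  let ?u = "LeftEnd # map Cell (spaced x1)" and ?v = "map Cell (spaced x2) @ [RightEnd]"
  let ?p = "program (l, r)"
  have words: "x1 \<in> lists (nonterminals G \<union> grammar_terminals G)"
    "x2 \<in> lists (nonterminals G \<union> grammar_terminals G)"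
    using assms(1) xy by auto
  have u: "left_part ?u" "before_block (last ?u)"
    using left_part_word[OF words(1)] by auto
  have "right_part [RightEnd]"
    by (simp add: right_part_def tape_alphabet_def)
  then have v: "right_part ?v" "after_block (hd ?v)"
    using right_part_word[OF words(2)] by (auto simp: after_block_def)
  have p: "?p \<in> programs"
    using program_in_programs[OF lr] .
  have wp: "map Write (spaced r) \<in> programs"
    using lr by (auto simp: programs_def program_def suffix_def intro!: bexI[of _ "(l, r)"])
  have nil: "[] \<in> programs"
    by (simp add: programs_def)
  have alph: "?u \<in> lists tape_alphabet" "?v \<in> lists tape_alphabet"
    "map Cell (spaced l) \<in> lists tape_alphabet" "map Cell (spaced r) \<in> lists tape_alphabet"
    "Cursor ?p \<in> tape_alphabet" "Cursor [] \<in> tape_alphabet"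
    using u v word_alphabet production_words[OF lr] Cursor_alphabet p nil
    by (auto simp: left_part_def right_part_def simp del: in_lists_conv_set)
  have no_cursor: "no_cursor (?u @ map Cell (spaced t) @ ?v)" for t
    by auto
  have "tape_step (?u @ map Cell (spaced l) @ ?v) (?u @ Cursor ?p # map Cell (spaced l) @ ?v)"
    by (rule tape_step.start[OF lr no_cursor[of l], of ?u "map Cell (spaced l) @ ?v"]) simp_all
  then have "sc_step simulation (?u @ map Cell (spaced l) @ ?v)
      (?u @ Cursor ?p # map Cell (spaced l) @ ?v)"
    using alph unfolding sc_step_iff by simp
  then have "?u @ map Cell (spaced l) @ ?v \<turnstile> ?u @ Cursor ?p # map Cell (spaced l) @ ?v"
    by blast
  also have "\<dots> \<turnstile> ?u @ Cursor (map Write (spaced r)) # ?v"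
    using simulate_erase[OF _ production_words(1)[OF lr] u v] p by (simp add: program_def)
  also have "\<dots> \<turnstile> ?u @ map Cell (spaced r) @ Cursor [] # ?v"
    by (rule simulate_write[OF wp production_words(2)[OF lr] u v])
  also have "\<dots> \<turnstile> ?u @ map Cell (spaced r) @ ?v"
  proof -
    have "tape_step (?u @ map Cell (spaced r) @ Cursor [] # ?v) (?u @ map Cell (spaced r) @ ?v)"
      by (rule tape_step.stop[of _ "?u @ map Cell (spaced r)" ?v]) auto
    then have "sc_step simulation (?u @ map Cell (spaced r) @ Cursor [] # ?v)
        (?u @ map Cell (spaced r) @ ?v)"
      using alph unfolding sc_step_iff by simp
    then show ?thesis by blast
  qed
  finally show ?thesis
    by (simp add: xy spaced_append)
qed

lemma clean_tape:
  assumes "no_cursor w" "w \<in> lists tape_alphabet"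
  shows "w \<turnstile> map (Cell \<circ> Some) (decode w)"
proof -
  \<comment> \<open>Letters are never cleaned away. The prefix \<open>x\<close> collects those
    already passed, and deletion continues behind them.\<close>
  have "map (Cell \<circ> Some) x @ w \<turnstile> map (Cell \<circ> Some) (x @ decode w)"
    if "map (Cell \<circ> Some) x @ w \<in> lists tape_alphabet" for x
    using assms(1) that
  proof (induction w arbitrary: x rule: list.induct)
    case (Cons c w)
    show ?case
    proof (cases "is_letter c")
      case True
      then obtain a where "c = Cell (Some a)"
        by (auto simp: is_letter_iff)
      then show ?thesis
        using Cons.IH[of "x @ [a]"] Cons.prems by simp
    next
      case False
      then have c: "c \<in> {Cell None, LeftEnd, RightEnd}"
        using Cons.prems(1) by (cases c rule: is_letter.cases) auto
      have "no_cursor (map (Cell \<circ> Some) x @ c # w)"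
        using Cons.prems(1) by auto
      then have "tape_step (map (Cell \<circ> Some) x @ c # w) (map (Cell \<circ> Some) x @ w)"
        using tape_step.clean[OF c] by blast
      then have "sc_step simulation (map (Cell \<circ> Some) x @ c # w) (map (Cell \<circ> Some) x @ w)"
        using Cons.prems(2) unfolding sc_step_iff by (simp add: comp_def)
      moreover have "map (Cell \<circ> Some) x @ w \<turnstile> map (Cell \<circ> Some) (x @ decode w)"
        using Cons.prems by (intro Cons.IH) auto
      moreover have "decode (c # w) = decode w"
        using c by auto
      ultimately show ?thesis
        by (simp add: comp_def converse_rtranclp_into_rtranclp)
    qed
  qed simp
  from this[of "[]"] show ?thesis
    using assms(2) by simp
qed

lemma decode_letters: "decode (map (Cell \<circ> Some) w) = w"
  by (induction w) auto

text \<open>A terminal tape carries no cursor, so the invariant makes its letters a sentential form.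
  Conversely, the axiom is the encoded start symbol, and cleaning strips separators and end markers
  from the encoding of the derived word.\<close>

lemma language_simulation:
  "sc_language simulation = map (Cell \<circ> Some) ` grammar_language G"
proof (intro equalityI subsetI)
  fix z assume "z \<in> sc_language simulation"
  then have z: "z \<in> lists ((Cell \<circ> Some) ` grammar_terminals G)"
    "tape_of [start_symbol G] \<turnstile> z"
    by (auto simp: sc_language_def simulation_def)
  have "sound (tape_of [start_symbol G])"
    by (rule sound.idle) (auto simp: sentential_def)
  with z(2) have "sound z"
    by (induction rule: rtranclp_induct) (auto simp: sc_step_iff intro: sound_step)
  moreover obtain w where w: "z = map (Cell \<circ> Some) w" "w \<in> lists (grammar_terminals G)"
    using z(1) unfolding lists_image by blast
  ultimately have "sentential w"
    using sound_sentential[of z] by (simp add: decode_letters)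
  then show "z \<in> map (Cell \<circ> Some) ` grammar_language G"
    using w by (auto simp: grammar_language_def sentential_def)
next
  fix z assume "z \<in> map (Cell \<circ> Some) ` grammar_language G"
  then obtain w where w: "z = map (Cell \<circ> Some) w" "w \<in> lists (grammar_terminals G)"
    "(grammar_step G)\<^sup>*\<^sup>* [start_symbol G] w"
    by (auto simp: grammar_language_def)
  from w(3) have "tape_of [start_symbol G] \<turnstile> tape_of w"
  proof induction
    case (step y z)
    then show ?case
      using simulate_grammar_step[OF grammar_steps_lists[OF type0 step(1)] step(2)] by simp
  qed simp
  also have "tape_of w \<turnstile> z"
  proof -
    have "tape_of w \<in> lists tape_alphabet"
      using word_alphabet[OF grammar_steps_lists[OF type0 w(3)]]
      by (simp add: tape_alphabet_def)
    then show ?thesis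
      using clean_tape[of "tape_of w"] by (auto simp: w(1))
  qed
  finally show "z \<in> sc_language simulation"
    using w(1,2) by (auto simp: sc_language_def simulation_def)
qed

end

theorem RE_subset_SC_INS_DEL:
  "RE \<subseteq> (SC_INS_DEL 2 2 (1, 0, 0) (1, 0, 0) :: 'a::infinite list set set)"
proof
  fix L :: "'a list set" assume "L \<in> RE"
  then obtain G where L: "L = grammar_language G" and G: "grammar_simulation G"
    by (auto simp: RE_def grammar_simulation_def)
  interpret grammar_simulation G by (rule G)
  have "finite (grammar_terminals G)"
    using type0 by (simp add: type0_grammar_def)
  then obtain f where f: "inj_on f (alphabet simulation)"
    "\<And>a. a \<in> grammar_terminals G \<Longrightarrow> f ((Cell \<circ> Some) a) = a"
    using renaming_exists[of "alphabet simulation" "grammar_terminals G" "Cell \<circ> Some"]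
      degree_simulation by (auto simp: inj_def sc_system_of_degree_def)
  have "L \<subseteq> lists (grammar_terminals G)"
    using L by (auto simp: grammar_language_def)
  then have "sc_language (rename_system f simulation) = L"
    using sc_language_rename[OF degree_simulation f(1)] f(2)
      map_rename_image[of L "grammar_terminals G" f "Cell \<circ> Some"]
    by (simp add: L language_simulation)
  then show "L \<in> SC_INS_DEL 2 2 (1, 0, 0) (1, 0, 0)"
    unfolding SC_INS_DEL_def
    using sc_system_of_degree_rename[OF degree_simulation]
      has_rules_of_size_rename[OF size_simulation] by blast
qed

theorem theorem2:
  shows "(SC_INS_DEL 2 2 (1, 0, 0) (1, 0, 0) :: 'a::infinite list set set) = RE"
  using SC_INS_DEL_subset_RE RE_subset_SC_INS_DEL by (rule equalityI)

end
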